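(* Let $a_0=a_1=a_2=a_3=\frac\pi2$. The connected component $C$ (of a given type) of $S:=S(\frac\pi2,\frac\pi2,\frac\pi2,\frac\pi2)$ with the action of the group $M$ is isomorphic to the space $\mathbb R^2/\{\pm1\}$ with the natural (linear) action of the congruence subgroup $\Gamma_2$ of $\mathrm{SL}_2\mathbb Z$, generated by $\begin{bmatrix}1&2\\0&1\end{bmatrix}$ and $\begin{bmatrix}1&0\\2&1\end{bmatrix}$. That is, there is a homeomorphism $C\to\mathbb R^2/\{\pm1\}$ that carries the group of transformations of $C$ given by $M$ onto the group of transformations of $\mathbb R^2/\{\pm1\}$ given by $\Gamma_2$. Therefore, almost every $M$-orbit is dense in $C$.
   Context: Let $V$ be a $2$-dimensional complex vector space with a hermitian form $\langle-,-\rangle$ (linear in the first argument) of signature $(1,1)$, and let $\mathrm BV:=\{p\in\mathbb P_{\mathbb C}V\mid\langle p,p\rangle>0\}$ be the hyperbolic plane of curvature $-1$, oriented by its complex structure; $\mathrm{PU}V$ is its group of orientation-preserving isometries. For $c\in\mathrm BV$ and $k\in\mathbb C$, $|k|=1$, the map $R_{c,k}:p\mapsto(\overline k-k)\frac{\langle p,c\rangle}{\langle c,c\rangle}c+kp$ acts on $\mathrm BV$ as the counterclockwise rotation about $c$ by the angle $2\arg k$. The space $S(a_0,a_1,a_2,a_3)$, $a_j\in\,]0,\pi[$. Put $k_j:=e^{a_ji}$. A hexagon of the first (respectively, second) type is a quadruple $(c_0,c_1,c_2,c_3)\in(\mathrm BV)^4$, considered up to the diagonal action of $\mathrm{PU}V$,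 such that $R_3R_2R_1R_0=1$ (respectively, $R_0R_1R_2R_3=1$) in $\mathrm{PU}V$, where $R_j:=R_{c_j,k_j}$. $S(a_0,a_1,a_2,a_3)$ is the disjoint union of the spaces of hexagons of the two types, with the natural topology. (When all $a_j=\frac\pi2$, each $R_j$ is the half-turn about $c_j$ and the space of hexagons of each type is connected.) Modifications. Write $A^B:=BAB^{-1}$. The involutions $n_1,n_2,n_3$ of $S(a_0,a_1,a_2,a_3)$ (acting from the right) interchange the types: on hexagons of the first type they send the relation $R_3R_2R_1R_0=1$ respectively to the second-type relations $R_0^{R_3^{-1}}R_1R_2^{R_1^{-1}}R_3=1$, $R_0^{R_3^{-1}}R_1^{R_2}R_2R_3=1$, $R_0^{R_1}R_1R_2^{R_3}R_3=1$; on hexagons of the second type they send $R_0R_1R_2R_3=1$ respectively to the first-type relations $R_3R_2^{R_1}R_1R_0^{R_3}=1$, $R_3R_2R_1^{R_2^{-1}}R_0^{R_3}=1$, $R_3R_2^{R_3^{-1}}R_1R_0^{R_1^{-1}}=1$. (In each relation the factor that is a conjugate of $R_j$ is the new $R_j$, and its fixed point is the new $c_j$.) $M_3$ is the group generated by $n_1,n_2,n_3$ and $M$ is its index $2$ subgroup of type-preserving elements, i.e., of products of an even number of the $n_j$'s. "Almost every" refers to the Lebesgue measure on $\mathbb R^2/\{\pm1\}$. The element $-1$ acts trivially on $\mathbb R^2/\{\pm1\}$, so it is immaterial whether it is included into $\Gamma_2$. *)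

theory Defs
  imports "HOL-Analysis.Analysis" "HOL-Algebra.Generated_Groups" "HOL-Algebra.Bij"
begin

definition quotient_topology :: "'a topology \<Rightarrow> ('a \<Rightarrow> 'b) \<Rightarrow> 'b topology" where
  "quotient_topology X q =
     topology (\<lambda>U. U \<subseteq> q ` topspace X \<and> openin X {x \<in> topspace X. q x \<in> U})"

lemma openin_quotient_topology:
  "openin (quotient_topology X q) U \<longleftrightarrow>
     U \<subseteq> q ` topspace X \<and> openin X {x \<in> topspace X. q x \<in> U}"
proof -
  have "istopology (\<lambda>U. U \<subseteq> q ` topspace X \<and> openin X {x \<in> topspace X. q x \<in> U})"
    unfolding istopology_def
  proof (intro conjI allI impI)
    fix S T
    assume "S \<subseteq> q ` topspace X \<and> openin X {x \<in> topspace X. q x \<in> S}"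
      and "T \<subseteq> q ` topspace X \<and> openin X {x \<in> topspace X. q x \<in> T}"
    moreover have "{x \<in> topspace X. q x \<in> S \<inter> T} =
        {x \<in> topspace X. q x \<in> S} \<inter> {x \<in> topspace X. q x \<in> T}"
      by auto
    ultimately show "S \<inter> T \<subseteq> q ` topspace X" "openin X {x \<in> topspace X. q x \<in> S \<inter> T}"
      by auto
  next
    fix K
    assume K: "\<forall>U\<in>K. U \<subseteq> q ` topspace X \<and> openin X {x \<in> topspace X. q x \<in> U}"
    then show "\<Union>K \<subseteq> q ` topspace X"
      by blast
    have "{x \<in> topspace X. q x \<in> \<Union>K} = (\<Union>U\<in>K. {x \<in> topspace X. q x \<in> U})"
      by auto
    then show "openin X {x \<in> topspace X. q x \<in> \<Union>K}"
      using K by auto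
  qed
  then show ?thesis
    by (simp add: quotient_topology_def)
qed

lemma topspace_quotient_topology [simp]: "topspace (quotient_topology X q) = q ` topspace X"
proof (rule antisym)
  show "topspace (quotient_topology X q) \<subseteq> q ` topspace X"
    using openin_topspace openin_quotient_topology by metis
  have "{x \<in> topspace X. q x \<in> q ` topspace X} = topspace X"
    by auto
  then have "openin (quotient_topology X q) (q ` topspace X)"
    by (simp add: openin_quotient_topology)
  then show "q ` topspace X \<subseteq> topspace (quotient_topology X q)"
    by (rule openin_subset)
qed

lemma quotient_map_quotient_topology: "quotient_map X (quotient_topology X q) q"
  by (simp add: quotient_map_def openin_quotient_topology)


type_synonym 'a quad = "'a \<times> 'a \<times> 'a \<times> 'a"

datatype hex_type = First | Second

fun other_type :: "hex_type \<Rightarrow> hex_type" where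
  "other_type First = Second"
| "other_type Second = First"

text \<open>The conjugate \<open>A^B = B A B\<^sup>-\<^sup>1\<close> of bijections.\<close>

definition conjugate :: "('a \<Rightarrow> 'a) \<Rightarrow> ('a \<Rightarrow> 'a) \<Rightarrow> 'a \<Rightarrow> 'a" where
  "conjugate A B = B \<circ> A \<circ> inv_into UNIV B"

text \<open>The new factors \<open>(R\<^sub>0, R\<^sub>1, R\<^sub>2, R\<^sub>3)\<close>, listed by index also for the first type, whose relation
  is \<open>R\<^sub>3 R\<^sub>2 R\<^sub>1 R\<^sub>0 = 1\<close>. The argument is the type of the old hexagon.\<close>

fun factors1 :: "hex_type \<Rightarrow> ('a \<Rightarrow> 'a) quad \<Rightarrow> ('a \<Rightarrow> 'a) quad" where
  "factors1 First (R0, R1, R2, R3) =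
     (conjugate R0 (inv_into UNIV R3), R1, conjugate R2 (inv_into UNIV R1), R3)"
| "factors1 Second (R0, R1, R2, R3) =
     (conjugate R0 R3, R1, conjugate R2 R1, R3)"

fun factors2 :: "hex_type \<Rightarrow> ('a \<Rightarrow> 'a) quad \<Rightarrow> ('a \<Rightarrow> 'a) quad" where
  "factors2 First (R0, R1, R2, R3) =
     (conjugate R0 (inv_into UNIV R3), conjugate R1 R2, R2, R3)"
| "factors2 Second (R0, R1, R2, R3) =
     (conjugate R0 R3, conjugate R1 (inv_into UNIV R2), R2, R3)"

fun factors3 :: "hex_type \<Rightarrow> ('a \<Rightarrow> 'a) quad \<Rightarrow> ('a \<Rightarrow> 'a) quad" where
  "factors3 First (R0, R1, R2, R3) =
     (conjugate R0 R1, R1, conjugate R2 R3, R3)"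
| "factors3 Second (R0, R1, R2, R3) =
     (conjugate R0 (inv_into UNIV R1), R1, conjugate R2 (inv_into UNIV R3), R3)"


locale hermitian_plane = vector_space scale
  for scale :: "complex \<Rightarrow> 'v::ab_group_add \<Rightarrow> 'v" +
  fixes form :: "'v \<Rightarrow> 'v \<Rightarrow> complex"
  assumes dim_2: "dim UNIV = 2"
    and form_add: "form (x + y) z = form x z + form y z"
    and form_scale: "form (scale a x) z = a * form x z"
    and form_hermitian: "form y x = cnj (form x y)"
    and signature_1_1: "\<exists>e f. form e f = 0 \<and> Re (form e e) > 0 \<and> Re (form f f) < 0"
begin

text \<open>The canonical topology of a finite-dimensional complex vector space: the finest one making all
  linear maps from \<open>\<complex>\<^sup>2\<close> continuous (since the dimension is 2, it is the topology transported along
  any linear isomorphism with \<open>\<complex>\<^sup>2\<close>).\<close>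

definition V_top :: "'v topology" where
  "V_top = topology (\<lambda>U. \<forall>u v. open {(z::complex, w::complex). scale z u + scale w v \<in> U})"

lemma openin_V_top:
  "openin V_top U \<longleftrightarrow> (\<forall>u v. open {(z::complex, w::complex). scale z u + scale w v \<in> U})"
proof -
  have "istopology (\<lambda>U. \<forall>u v. open {(z::complex, w::complex). scale z u + scale w v \<in> U})"
    unfolding istopology_def
  proof (intro conjI allI impI)
    fix S T u v
    assume "\<forall>u v. open {(z::complex, w::complex). scale z u + scale w v \<in> S}"
      and "\<forall>u v. open {(z::complex, w::complex). scale z u + scale w v \<in> T}"
    moreover have "{(z::complex, w::complex). scale z u + scale w v \<in> S \<inter> T} =
        {(z, w). scale z u + scale w v \<in> S} \<inter> {(z, w). scale z u + scale w v \<in> T}"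
      by auto
    ultimately show "open {(z::complex, w::complex). scale z u + scale w v \<in> S \<inter> T}"
      by (simp add: open_Int)
  next
    fix K u v
    assume "\<forall>U\<in>K. \<forall>u v. open {(z::complex, w::complex). scale z u + scale w v \<in> U}"
    moreover have "{(z::complex, w::complex). scale z u + scale w v \<in> \<Union>K} =
        (\<Union>U\<in>K. {(z, w). scale z u + scale w v \<in> U})"
      by auto
    ultimately show "open {(z::complex, w::complex). scale z u + scale w v \<in> \<Union>K}"
      by (simp add: open_UN)
  qed
  then show ?thesis
    by (simp add: V_top_def)
qed

lemma topspace_V_top [simp]: "topspace V_top = UNIV"
proof -
  have "openin V_top UNIV"
    by (simp add: openin_V_top case_prod_unfold)
  then show ?thesis
    using openin_subset by blast
qed

text \<open>Points of the projective line of \<open>V\<close> are the one-dimensional subspaces.\<close>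

definition PV :: "'v set set" where
  "PV = {span {v} |v. v \<noteq> 0}"

definition PV_top :: "'v set topology" where
  "PV_top = quotient_topology (subtopology V_top (- {0})) (\<lambda>v. span {v})"

definition BV :: "'v set set" where
  "BV = {span {v} |v. Re (form v v) > 0}"

definition BV_top :: "'v set topology" where
  "BV_top = subtopology PV_top BV"

text \<open>An element of \<open>PU V\<close> is represented by a unitary \<open>g\<close> and acts on projective points by taking
  images; \<open>g\<close> represents the unit of \<open>PU V\<close> iff it fixes all projective points.\<close>

definition unitary_group :: "('v \<Rightarrow> 'v) set" where
  "unitary_group =
     {g. Vector_Spaces.linear scale scale g \<and> bij g \<and> (\<forall>x y. form (g x) (g y) = form x y)}"

definition trivial_in_PU :: "('v \<Rightarrow> 'v) \<Rightarrow> bool" where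
  "trivial_in_PU g \<longleftrightarrow> (\<forall>p\<in>PV. g ` p = p)"

text \<open>The map \<open>R\<^bsub>c,k\<^esub>\<close> on \<open>V\<close>; it does not depend on the chosen representative of \<open>c\<close>.\<close>

definition rotation :: "'v set \<Rightarrow> complex \<Rightarrow> 'v \<Rightarrow> 'v" where
  "rotation c k p =
     (let v = (SOME v. v \<in> c \<and> v \<noteq> 0)
      in scale ((cnj k - k) * (form p v / form v v)) v + scale k p)"

definition rotations :: "real \<Rightarrow> real \<Rightarrow> real \<Rightarrow> real \<Rightarrow> 'v set quad \<Rightarrow> ('v \<Rightarrow> 'v) quad" where
  "rotations a0 a1 a2 a3 = (\<lambda>(c0, c1, c2, c3).
     (rotation c0 (exp (a0 * \<i>)), rotation c1 (exp (a1 * \<i>)),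
      rotation c2 (exp (a2 * \<i>)), rotation c3 (exp (a3 * \<i>))))"

definition hexagon_quads :: "hex_type \<Rightarrow> real \<Rightarrow> real \<Rightarrow> real \<Rightarrow> real \<Rightarrow> 'v set quad set" where
  "hexagon_quads ty a0 a1 a2 a3 = {c \<in> BV \<times> BV \<times> BV \<times> BV.
     case rotations a0 a1 a2 a3 c of (R0, R1, R2, R3) \<Rightarrow>
       (case ty of
          First \<Rightarrow> trivial_in_PU (R3 \<circ> R2 \<circ> R1 \<circ> R0)
        | Second \<Rightarrow> trivial_in_PU (R0 \<circ> R1 \<circ> R2 \<circ> R3))}"

definition PU_class :: "'v set quad \<Rightarrow> 'v set quad set" where
  "PU_class = (\<lambda>(c0, c1, c2, c3). {(g ` c0, g ` c1, g ` c2, g ` c3) |g. g \<in> unitary_group})"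

definition hexagon_space ::
  "hex_type \<Rightarrow> real \<Rightarrow> real \<Rightarrow> real \<Rightarrow> real \<Rightarrow> 'v set quad set topology" where
  "hexagon_space ty a0 a1 a2 a3 =
     quotient_topology
       (subtopology
         (prod_topology BV_top (prod_topology BV_top (prod_topology BV_top BV_top)))
         (hexagon_quads ty a0 a1 a2 a3))
       PU_class"

definition S :: "real \<Rightarrow> real \<Rightarrow> real \<Rightarrow> real \<Rightarrow> (hex_type \<times> 'v set quad set) topology" where
  "S a0 a1 a2 a3 = sum_topology (\<lambda>ty. hexagon_space ty a0 a1 a2 a3) UNIV"

definition fixed_point :: "('v \<Rightarrow> 'v) \<Rightarrow> 'v set" where
  "fixed_point A = (THE p. p \<in> BV \<and> A ` p = p)"

definition modify_quad ::
  "(('v \<Rightarrow> 'v) quad \<Rightarrow> ('v \<Rightarrow> 'v) quad) \<Rightarrow> real \<Rightarrow> real \<Rightarrow> real \<Rightarrow> real \<Rightarrow> 'v set quad \<Rightarrow> 'v set quad"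
  where
  "modify_quad F a0 a1 a2 a3 c =
     (case F (rotations a0 a1 a2 a3 c) of (T0, T1, T2, T3) \<Rightarrow>
        (fixed_point T0, fixed_point T1, fixed_point T2, fixed_point T3))"

definition modification ::
  "(hex_type \<Rightarrow> ('v \<Rightarrow> 'v) quad \<Rightarrow> ('v \<Rightarrow> 'v) quad) \<Rightarrow> real \<Rightarrow> real \<Rightarrow> real \<Rightarrow> real \<Rightarrow>
     hex_type \<times> 'v set quad set \<Rightarrow> hex_type \<times> 'v set quad set" where
  "modification F a0 a1 a2 a3 = (\<lambda>x\<in>topspace (S a0 a1 a2 a3).
     (other_type (fst x), modify_quad (F (fst x)) a0 a1 a2 a3 ` snd x))"

text \<open>The groups of transformations given by \<open>M\<^sub>3\<close> and \<open>M\<close>. Right and left actions have the same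
  transformations, as groups are closed under inverses.\<close>

definition M3 :: "real \<Rightarrow> real \<Rightarrow> real \<Rightarrow> real \<Rightarrow>
    (hex_type \<times> 'v set quad set \<Rightarrow> hex_type \<times> 'v set quad set) set" where
  "M3 a0 a1 a2 a3 = generate (BijGroup (topspace (S a0 a1 a2 a3)))
     {modification factors1 a0 a1 a2 a3, modification factors2 a0 a1 a2 a3,
      modification factors3 a0 a1 a2 a3}"

definition M :: "real \<Rightarrow> real \<Rightarrow> real \<Rightarrow> real \<Rightarrow>
    (hex_type \<times> 'v set quad set \<Rightarrow> hex_type \<times> 'v set quad set) set" where
  "M a0 a1 a2 a3 =
     {m \<in> M3 a0 a1 a2 a3. \<forall>x\<in>topspace (S a0 a1 a2 a3). fst (m x) = fst x}"

definition component_of_type ::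
  "hex_type \<Rightarrow> real \<Rightarrow> real \<Rightarrow> real \<Rightarrow> real \<Rightarrow> (hex_type \<times> 'v set quad set) set" where
  "component_of_type ty a0 a1 a2 a3 = {x \<in> topspace (S a0 a1 a2 a3). fst x = ty}"

end


definition SL2Z :: "(int^2^2) monoid" where
  "SL2Z = \<lparr>carrier = {A. det A = 1}, monoid.mult = (**), one = mat 1\<rparr>"

definition Gamma2 :: "(int^2^2) set" where
  "Gamma2 = generate SL2Z {vector [vector [1, 2], vector [0, 1]], vector [vector [1, 0], vector [2, 1]]}"

definition pm_class :: "real^2 \<Rightarrow> (real^2) set" where
  "pm_class v = {v, - v}"

definition plane_mod_pm :: "(real^2) set topology" where
  "plane_mod_pm = quotient_topology euclidean pm_class"

definition linear_action :: "int^2^2 \<Rightarrow> (real^2) set \<Rightarrow> (real^2) set" where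
  "linear_action A = (\<lambda>p\<in>topspace plane_mod_pm. (\<lambda>v. map_matrix real_of_int A *v v) ` p)"

end

(*
  The product of the half-turns about two points c, d is the translation along the line cd by twice
  their distance. So four half-turns multiply to 1 iff their centers lie on a common geodesic, with
  signed positions t_0 - t_1 + t_2 - t_3 = 0; modulo isometries, only (x, y) = (t_1 - t_0, t_2 - t_1)
  up to a common sign remains. On this quotient of the plane the modifications act by
  n_1 = U N, n_2 = N, n_3 = L N, with N = diag(1, -1) and U, L the two generators of Gamma_2; as N
  normalizes Gamma_2, the products of evenly many of them form Gamma_2 up to sign.

  If v has irrational slope, the Euclidean algorithm with even quotients produces arbitrarily small
  vectors in the orbit of v. Shearing these by powers of U gives points near every point of the
  x-axis, and the images of the x-axis under Gamma_2 come close to every w: the images of the axis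
  under A with A^-1 w small.
*)

theory Submission
  imports Defs
begin

section \<open>The congruence subgroup\<close>

text \<open>That the centers lie on one geodesic has two cases. If c_0 and c_1 differ, R_1 R_0 is a
  translation with two fixed null lines, and R_2 must exchange them, which puts c_2 on the axis. If
  c_0 = c_1, no axis is determined, and a rotation about this point is free to move c_2 onto the
  standard geodesic. The normal form depends on such choices, so it is not evidently continuous. The
  map to the plane is therefore built from the distances between c_0, c_1, c_2, which are invariant
  and continuous; the quotient by +-1 is what lets its two sign cases be glued. As a linear map a
  half-turn squares to -1, so it is an involution on lines only, and all relations are stated for
  images of lines. There R_j is its own inverse; hence both types consist of the same quadruples,
  and the modifications are given by the same formulas on both. In the Euclidean algorithm with even
  quotients, a remainder is bounded by the divisor only, not by half of it. There is no geometric
  decay, and small vectors come from an infimum argument instead.\<close>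

abbreviation int_act :: "int^2^2 \<Rightarrow> real^2 \<Rightarrow> real^2"
  where "int_act A v \<equiv> map_matrix real_of_int A *v v"

abbreviation mat2 :: "int \<Rightarrow> int \<Rightarrow> int \<Rightarrow> int \<Rightarrow> int^2^2"
  where "mat2 a b c d \<equiv> vector [vector [a, b], vector [c, d]]"

lemma mat2_cases: obtains a b c d where "A = mat2 a b c d"
proof
  show "A = mat2 (A$1$1) (A$1$2) (A$2$1) (A$2$2)"
    by (simp add: vec_eq_iff forall_2)
qed

lemma mat2_mult:
  "mat2 a b c d ** mat2 a' b' c' d' = mat2 (a*a' + b*c') (a*b' + b*d') (c*a' + d*c') (c*b' + d*d')"
  by (simp add: vec_eq_iff forall_2 matrix_matrix_mult_def sum_2)

lemma mat2_1: "mat 1 = mat2 1 0 0 1"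
  by (simp add: vec_eq_iff forall_2 mat_def)

lemma det_mat2: "det (mat2 a b c d) = a * d - b * c"
  by (simp add: det_2)

lemma int_act_mat2:
  "int_act (mat2 a b c d) v $ 1 = a * v$1 + b * v$2"
  "int_act (mat2 a b c d) v $ 2 = c * v$1 + d * v$2"
  by (simp_all add: matrix_vector_mult_def map_matrix_def sum_2)

lemma int_act_mult: "int_act (A ** B) v = int_act A (int_act B v)"
proof -
  obtain a b c d where A: "A = mat2 a b c d"
    by (rule mat2_cases)
  obtain a' b' c' d' where B: "B = mat2 a' b' c' d'"
    by (rule mat2_cases)
  show ?thesis
    unfolding A B mat2_mult by (simp add: vec_eq_iff forall_2 int_act_mat2 algebra_simps)
qed

lemma int_act_1: "int_act (mat 1) v = v"
  by (simp add: mat2_1 vec_eq_iff forall_2 int_act_mat2)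

lemma int_act_minus: "int_act A (- v) = - int_act A v"
  by (simp add: vector_matrix_mul_rid matrix_vector_mult_def vec_eq_iff sum_negf)

lemma mat2_adjugate:
  assumes "a * d - b * c = 1"
  shows "mat2 d (-b) (-c) a ** mat2 a b c d = mat 1" "mat2 a b c d ** mat2 d (-b) (-c) a = mat 1"
proof -
  have "d * a - b * c = 1" "a * d - c * b = 1" "- (c * b) + a * d = 1" "- (b * c) + d * a = 1"
    using assms by (simp_all add: mult.commute)
  then show "mat2 d (-b) (-c) a ** mat2 a b c d = mat 1" "mat2 a b c d ** mat2 d (-b) (-c) a = mat 1"
    using assms by (simp_all add: mat2_mult mat2_1 mult.commute)
qed

lemma group_SL2Z: "group SL2Z"
proof (rule groupI)
  fix A assume A: "A \<in> carrier SL2Z"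
  obtain a b c d where abcd: "A = mat2 a b c d"
    by (rule mat2_cases)
  then have "a * d - b * c = 1"
    using A by (simp add: SL2Z_def det_mat2)
  then show "\<exists>B\<in>carrier SL2Z. B \<otimes>\<^bsub>SL2Z\<^esub> A = \<one>\<^bsub>SL2Z\<^esub>"
    using mat2_adjugate(1)
    by (intro bexI[of _ "mat2 d (-b) (-c) a"]) (auto simp: SL2Z_def abcd det_mat2 mult.commute)
qed (auto simp: SL2Z_def det_mul matrix_mul_assoc)

interpretation SL2Z: group SL2Z
  by (rule group_SL2Z)

lemma inv_SL2Z:
  assumes "a * d - b * c = 1"
  shows "inv\<^bsub>SL2Z\<^esub> (mat2 a b c d) = mat2 d (-b) (-c) a"
  by (rule SL2Z.inv_equality) (use assms mat2_adjugate in \<open>auto simp: SL2Z_def det_mat2 mult.commute\<close>)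

lemma Gamma2_subset: "Gamma2 \<subseteq> carrier SL2Z"
  unfolding Gamma2_def by (rule SL2Z.generate_incl) (simp add: SL2Z_def det_mat2)

lemma Gamma2_mult: "A \<in> Gamma2 \<Longrightarrow> B \<in> Gamma2 \<Longrightarrow> A ** B \<in> Gamma2"
  unfolding Gamma2_def using generate.eng[of A SL2Z _ B] by (simp add: SL2Z_def)

lemma Gamma2_one: "mat 1 \<in> Gamma2"
  unfolding Gamma2_def using generate.one[of SL2Z] by (simp add: SL2Z_def)

lemma Gamma2_inv:
  assumes "mat2 a b c d \<in> Gamma2"
  shows "mat2 d (-b) (-c) a \<in> Gamma2"
proof -
  have "a * d - b * c = 1"
    using assms Gamma2_subset by (auto simp: SL2Z_def det_mat2)
  from inv_SL2Z[OF this] show ?thesis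
    using assms SL2Z.generate_m_inv_closed[of "{mat2 1 2 0 1, mat2 1 0 2 1}" "mat2 a b c d"]
    by (auto simp: Gamma2_def SL2Z_def det_mat2)
qed

lemma Gamma2_generators: "mat2 1 2 0 1 \<in> Gamma2" "mat2 1 0 2 1 \<in> Gamma2"
  unfolding Gamma2_def by (auto intro: generate.incl)

lemma Gamma2_upper: "mat2 1 (2 * k) 0 1 \<in> Gamma2"
proof (induction k rule: int_induct[of _ 0])
  case base
  then show ?case
    using Gamma2_one by (simp add: mat2_1)
next
  case (step1 i)
  then show ?case
    using Gamma2_mult[OF step1(2) Gamma2_generators(1)] by (simp add: mat2_mult algebra_simps)
next
  case (step2 i)
  then show ?case
    using Gamma2_mult[OF step2(2) Gamma2_inv[OF Gamma2_generators(1)]]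
    by (simp add: mat2_mult algebra_simps)
qed

lemma Gamma2_lower: "mat2 1 0 (2 * k) 1 \<in> Gamma2"
proof (induction k rule: int_induct[of _ 0])
  case base
  then show ?case
    using Gamma2_one by (simp add: mat2_1)
next
  case (step1 i)
  then show ?case
    using Gamma2_mult[OF step1(2) Gamma2_generators(2)] by (simp add: mat2_mult algebra_simps)
next
  case (step2 i)
  then show ?case
    using Gamma2_mult[OF step2(2) Gamma2_inv[OF Gamma2_generators(2)]]
    by (simp add: mat2_mult algebra_simps)
qed

text \<open>The N of the overview. Its determinant is -1, so it lies outside \<open>SL2Z\<close>,
  and products with it are handled as bare matrices.\<close>

definition reflection :: "int^2^2"
  where "reflection = mat2 1 0 0 (-1)"

lemma reflection_reflection: "reflection ** reflection = mat 1"
  by (simp add: reflection_def mat2_mult mat2_1)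

lemma mult_reflection_reflection: "A ** reflection ** reflection = A"
  by (simp add: reflection_reflection flip: matrix_mul_assoc)

text \<open>Conjugation by \<open>reflection\<close> inverts both generators. This allows the
  reflections in a product of modifications to be collected on the right.\<close>

lemma Gamma2_conjugate_reflection:
  assumes "A \<in> Gamma2"
  shows "reflection ** A ** reflection \<in> Gamma2"
proof -
  have A: "A \<in> generate SL2Z {mat2 1 2 0 1, mat2 1 0 2 1}"
    using assms by (simp add: Gamma2_def)
  then show ?thesis
  proof (induction rule: generate.induct)
    case one
    then show ?case
      using Gamma2_one by (simp add: SL2Z_def reflection_reflection)
  next
    case (incl h)
    then show ?case
      using Gamma2_upper[of "- 1"] Gamma2_lower[of "- 1"] by (auto simp: reflection_def mat2_mult)
  next
    case (inv h)
    then show ?case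
      using Gamma2_upper[of 1] Gamma2_lower[of 1] by (auto simp: inv_SL2Z reflection_def mat2_mult)
  next
    case (eng A B)
    have "reflection ** (A ** B) ** reflection = (reflection ** A ** reflection) ** (reflection ** B ** reflection)"
      by (simp add: matrix_mul_assoc mult_reflection_reflection)
    then show ?case
      using Gamma2_mult[OF eng.IH] by (simp add: SL2Z_def)
  qed
qed

subsection \<open>Density of orbits\<close>

lemma round_multiple:
  fixes a b :: real
  assumes "a \<noteq> 0"
  obtains k :: int where "\<bar>b - 2 * k * a\<bar> \<le> \<bar>a\<bar>"
proof
  have "\<bar>of_int (round (b / (2 * a))) - b / (2 * a)\<bar> \<le> 1 / 2"
    by (rule of_int_round_abs_le)
  then have "\<bar>2 * a\<bar> * \<bar>of_int (round (b / (2 * a))) - b / (2 * a)\<bar> \<le> \<bar>2 * a\<bar> * (1 / 2)"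
    by (intro mult_left_mono) auto
  then have "\<bar>2 * a * (of_int (round (b / (2 * a))) - b / (2 * a))\<bar> \<le> \<bar>a\<bar>"
    unfolding abs_mult by (simp add: abs_mult)
  also have "2 * a * (of_int (round (b / (2 * a))) - b / (2 * a)) = - (b - 2 * round (b / (2 * a)) * a)"
    using assms by (simp add: right_diff_distrib)
  finally show "\<bar>b - 2 * round (b / (2 * a)) * a\<bar> \<le> \<bar>a\<bar>"
    by simp
qed

text \<open>Let m be the infimum of the larger entries. Each entry a of a pair is at least m,
  because reducing the other entry modulo 2 * a gives a pair with maximum a. If m were positive, a
  pair with both entries in [m, 2 * m) could be lowered by a fixed d > 0 again and again, until it
  falls below m. The condition \<open>a \<noteq> b\<close> is what makes d nonzero.\<close>

lemma even_euclid_descent: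
  fixes P :: "(real \<times> real) set"
  assumes ne: "P \<noteq> {}" and "\<epsilon> > 0"
    and pos: "\<And>a b. (a, b) \<in> P \<Longrightarrow> 0 < a \<and> a \<noteq> b"
    and swap: "\<And>a b. (a, b) \<in> P \<Longrightarrow> (b, a) \<in> P"
    and reduce: "\<And>a b k. (a, b) \<in> P \<Longrightarrow> (a, \<bar>b - 2 * of_int k * a\<bar>) \<in> P"
  obtains a b where "(a, b) \<in> P" "a < \<epsilon>" "b < \<epsilon>"
proof (rule ccontr)
  assume contr: "\<not> thesis"
  define X where "X = (\<lambda>(a, b). max a b) ` P"
  have X: "X \<noteq> {}" "\<And>x. x \<in> X \<Longrightarrow> \<epsilon> \<le> x"
    using ne contr that by (force simp: X_def)+
  define m where "m = Inf X"
  have m: "\<epsilon> \<le> m"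
    unfolding m_def using X by (rule cInf_greatest)
  have bdd: "bdd_below X"
    using X(2) by (rule bdd_belowI)
  have ge: "m \<le> a" if ab: "(a, b) \<in> P" for a b
  proof -
    obtain k :: int where k: "\<bar>b - 2 * k * a\<bar> \<le> \<bar>a\<bar>"
      using round_multiple[of a b] pos[OF ab] by auto
    then have "max a \<bar>b - 2 * k * a\<bar> \<in> X"
      using reduce[OF ab, of k] unfolding X_def by force
    then have "m \<le> max a \<bar>b - 2 * k * a\<bar>"
      unfolding m_def using bdd by (rule cInf_lower)
    then show ?thesis
      using k pos[OF ab] by auto
  qed
  have "m < 2 * m"
    using m \<open>\<epsilon> > 0\<close> by simp
  then obtain x where "x \<in> X" "x < 2 * m"
    using cInf_lessD[OF X(1)] unfolding m_def by blast
  then obtain a0 b0 where "(a0, b0) \<in> P" "max a0 b0 < 2 * m"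
    unfolding X_def by auto
  then obtain a b where ab: "(a, b) \<in> P" "a < b" "b < 2 * m"
    using swap pos by (metis linorder_neqE_linordered_idom max_less_iff_conj)
  define d where "d = b - a"
  \<comment> \<open>Near the infimum the quotient is always \<open>2\<close>, which lowers both entries by the same \<open>d\<close>.\<close>
  have "(a - n * d, b - n * d) \<in> P" for n :: nat
  proof (induction n)
    case 0
    then show ?case
      using ab by simp
  next
    case (Suc n)
    have "0 \<le> n * d"
      using ab by (simp add: d_def)
    then have "\<bar>(b - n * d) - 2 * of_int 1 * (a - n * d)\<bar> = a - Suc n * d"
      using ge[OF Suc] ab by (simp add: d_def algebra_simps)
    moreover have "a - n * d = b - Suc n * d"
      by (simp add: d_def algebra_simps)
    ultimately show ?case
      using swap[OF reduce[OF Suc, of 1]] by simp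
  qed
  then have "m \<le> a - n * d" for n :: nat
    using ge by blast
  moreover obtain n :: nat where "a < n * d"
    using reals_Archimedean3[of d] ab by (auto simp: d_def)
  ultimately show False
    using m \<open>\<epsilon> > 0\<close> by (smt (verit))
qed

definition irrational_slope :: "real^2 \<Rightarrow> bool"
  where "irrational_slope v \<longleftrightarrow> (\<forall>p q. of_int p * v$1 + of_int q * v$2 = 0 \<longrightarrow> p = 0 \<and> q = 0)"

text \<open>A relation (p, q) between the coordinates of A v is the relation (p, q) A between those
  of v, and A is invertible.\<close>

lemma irrational_slope_int_act:
  assumes "A \<in> Gamma2" "irrational_slope v"
  shows "irrational_slope (int_act A v)"
proof -
  obtain a b c d where A: "A = mat2 a b c d"
    by (rule mat2_cases)
  have det: "a * d - b * c = 1"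
    using assms(1) Gamma2_subset by (auto simp: A SL2Z_def det_mat2)
  show ?thesis
    unfolding irrational_slope_def
  proof (intro allI impI)
    fix p q :: int
    assume "of_int p * int_act A v $ 1 + of_int q * int_act A v $ 2 = 0"
    then have "real_of_int (p * a + q * c) * v$1 + real_of_int (p * b + q * d) * v$2 = 0"
      by (simp add: A int_act_mat2 algebra_simps)
    then have "p * a + q * c = 0 \<and> p * b + q * d = 0"
      using assms(2) unfolding irrational_slope_def by blast
    then show "p = 0 \<and> q = 0"
      using det by algebra
  qed
qed

lemma irrational_slopeD:
  assumes "irrational_slope v"
  shows "v$1 \<noteq> 0" "v$2 \<noteq> 0" "\<bar>v$1\<bar> \<noteq> \<bar>v$2\<bar>"
proof -
  have *: "of_int p * v$1 + of_int q * v$2 = 0 \<Longrightarrow> p = 0 \<and> q = 0" for p q :: int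
    using assms by (auto simp: irrational_slope_def)
  show "v$1 \<noteq> 0" "v$2 \<noteq> 0" "\<bar>v$1\<bar> \<noteq> \<bar>v$2\<bar>"
    using *[of 1 0] *[of 0 1] *[of 1 1] *[of 1 "-1"] by (auto simp: abs_if split: if_splits)
qed

text \<open>The descent wants pairs that may be swapped, but \<open>Gamma2\<close> contains no
  exchange of the coordinates; hence \<open>P\<close> collects the absolute values in both orders.
  Its reductions are realized by the lower and the upper shears respectively.\<close>

lemma orbit_small:
  assumes v: "irrational_slope v" and "\<epsilon> > 0"
  obtains A where "A \<in> Gamma2" "\<bar>int_act A v $ 1\<bar> < \<epsilon>" "\<bar>int_act A v $ 2\<bar> < \<epsilon>"
proof -
  define O' where "O' = (\<lambda>A. int_act A v) ` Gamma2"
  define P where "P = (\<lambda>w. (\<bar>w$1\<bar>, \<bar>w$2\<bar>)) ` O' \<union> (\<lambda>w. (\<bar>w$2\<bar>, \<bar>w$1\<bar>)) ` O'"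
  have O': "int_act A w \<in> O'" if "w \<in> O'" "A \<in> Gamma2" for A w
    using that Gamma2_mult unfolding O'_def by (auto simp flip: int_act_mult)
  have irr: "irrational_slope w" if "w \<in> O'" for w
    using that v irrational_slope_int_act unfolding O'_def by blast
  \<comment> \<open>Absolute values forget the signs of x and y, so the shear needed is -k when the
    signs agree and k when they differ.\<close>
  have red: "\<exists>j::int. \<bar>y + 2 * of_int j * x\<bar> = \<bar>\<bar>y\<bar> - 2 * of_int k * \<bar>x\<bar>\<bar>" for x y :: real and k :: int
  proof -
    have "\<exists>\<sigma>::int. \<bar>y\<bar> - 2 * of_int k * \<bar>x\<bar> = y + 2 * of_int (\<sigma> * k) * x \<or>
        \<bar>y\<bar> - 2 * of_int k * \<bar>x\<bar> = - (y + 2 * of_int (\<sigma> * k) * x)"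
    proof (cases "(0 \<le> x) = (0 \<le> y)")
      case True
      then have "(\<bar>x\<bar> = x \<and> \<bar>y\<bar> = y) \<or> (\<bar>x\<bar> = - x \<and> \<bar>y\<bar> = - y)"
        by linarith
      then show ?thesis
        by (intro exI[of _ "- 1"]) auto
    next
      case False
      then have "(\<bar>x\<bar> = x \<and> \<bar>y\<bar> = - y) \<or> (\<bar>x\<bar> = - x \<and> \<bar>y\<bar> = y)"
        by linarith
      then show ?thesis
        by (intro exI[of _ 1]) auto
    qed
    then obtain \<sigma> :: int where "\<bar>\<bar>y\<bar> - 2 * of_int k * \<bar>x\<bar>\<bar> = \<bar>y + 2 * of_int (\<sigma> * k) * x\<bar>"
      using abs_minus_cancel by metis
    then show ?thesis
      by metis
  qed
  obtain a b where ab: "(a, b) \<in> P" "a < \<epsilon>" "b < \<epsilon>"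
  proof (rule even_euclid_descent[OF _ \<open>\<epsilon> > 0\<close>, of P])
    show "P \<noteq> {}"
      using Gamma2_one unfolding P_def O'_def by blast
    show "0 < a \<and> a \<noteq> b" if "(a, b) \<in> P" for a b
      using that irrational_slopeD[OF irr] irrational_slopeD(3)[OF irr, symmetric] by (auto simp: P_def)
    show "(b, a) \<in> P" if "(a, b) \<in> P" for a b
      using that unfolding P_def by auto
    show "(a, \<bar>b - 2 * of_int k * a\<bar>) \<in> P" if "(a, b) \<in> P" for a b and k :: int
    proof -
      from that consider w where "w \<in> O'" "a = \<bar>w$1\<bar>" "b = \<bar>w$2\<bar>" | w where "w \<in> O'" "a = \<bar>w$2\<bar>" "b = \<bar>w$1\<bar>"
        unfolding P_def by auto
      then show ?thesis
      proof cases
        case 1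
        obtain j :: int where j: "\<bar>w$2 + 2 * of_int j * w$1\<bar> = \<bar>\<bar>w$2\<bar> - 2 * of_int k * \<bar>w$1\<bar>\<bar>"
          using red by blast
        have "int_act (mat2 1 0 (2 * j) 1) w \<in> O'"
          using O' 1 Gamma2_lower by blast
        then show ?thesis
          unfolding P_def 1 using j
          by (intro UnI1 image_eqI) (auto simp: int_act_mat2 add.commute)
      next
        case 2
        obtain j :: int where j: "\<bar>w$1 + 2 * of_int j * w$2\<bar> = \<bar>\<bar>w$1\<bar> - 2 * of_int k * \<bar>w$2\<bar>\<bar>"
          using red by blast
        have "int_act (mat2 1 (2 * j) 0 1) w \<in> O'"
          using O' 2 Gamma2_upper by blast
        then show ?thesis
          unfolding P_def 2 using j
          by (intro UnI2 image_eqI) (auto simp: int_act_mat2)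
      qed
    qed
  qed
  then show thesis
    using that unfolding P_def O'_def by auto
qed

text \<open>A countable union of lines through the origin, one for each nonzero integer relation.
  This is the exceptional set behind "almost every".\<close>

lemma negligible_rational_slope: "negligible {v. \<not> irrational_slope v}"
proof -
  define I where "I = - {(0::int, 0::int)}"
  have "negligible {v. (vector [of_int p, of_int q] :: real^2) \<bullet> v = 0}" if "(p, q) \<in> I" for p q
  proof (rule negligible_hyperplane)
    show "(vector [of_int p, of_int q] :: real^2) \<noteq> 0 \<or> (0::real) \<noteq> 0"
      using that by (auto simp: I_def vec_eq_iff forall_2)
  qed
  then have "negligible (\<Union>(p, q)\<in>I. {v. (vector [of_int p, of_int q] :: real^2) \<bullet> v = 0})"
    by (intro negligible_countable_Union) auto
  then show ?thesis
    by (rule negligible_subset) (auto simp: irrational_slope_def I_def inner_vec_def sum_2)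
qed

lemma AE_irrational_slope: "AE v in lebesgue. irrational_slope v"
  using negligible_rational_slope AE_not_in[of "{v. \<not> irrational_slope v}" lebesgue]
  by (simp add: negligible_iff_null_sets)

lemma open_irrational_slope:
  assumes "open W" "W \<noteq> {}"
  obtains w where "w \<in> W" "irrational_slope w"
  using that open_not_negligible[OF assms] negligible_subset[OF negligible_rational_slope, of W] by blast

lemma norm_le_components: "norm (v :: real^2) \<le> \<bar>v$1\<bar> + \<bar>v$2\<bar>"
  using norm_le_l1_cart[of v] by (simp add: sum_2)

lemma continuous_int_act: "continuous_on S (int_act A)"
  by (intro linear_continuous_on matrix_vector_mul_bounded_linear)

lemma orbit_dense:
  assumes v: "irrational_slope v" and "open W" "W \<noteq> {}"
  obtains A where "A \<in> Gamma2" "int_act A v \<in> W"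
proof -
  \<comment> \<open>The target also gets an irrational slope, since \<open>orbit_small\<close> is
    applied to it as well.\<close>
  obtain w where w: "w \<in> W" "irrational_slope w"
    using open_irrational_slope assms by blast
  obtain \<epsilon> where \<epsilon>: "\<epsilon> > 0" "ball w \<epsilon> \<subseteq> W"
    using w(1) \<open>open W\<close> open_contains_ball by blast
  obtain B where B: "B \<in> Gamma2" "\<bar>int_act B w $ 2\<bar> < \<epsilon>"
    using orbit_small[OF w(2) \<epsilon>(1)] by blast
  obtain a b c d where B': "B = mat2 a b c d"
    by (rule mat2_cases)
  have det: "a * d - b * c = 1"
    using B(1) Gamma2_subset by (auto simp: B' SL2Z_def det_mat2)
  define B1 where "B1 = mat2 d (-b) (-c) a"
  have B1: "B1 \<in> Gamma2"
    using Gamma2_inv B(1) unfolding B' B1_def by blast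
  define y where "y = c * w$1 + d * w$2"
  have y: "\<bar>y\<bar> < \<epsilon>"
    using B(2) by (simp add: B' int_act_mat2 y_def)
  \<comment> \<open>The line \<open>B\<inverse>(\<real> \<times> 0)\<close> passes near \<open>w\<close>, as its direction is a nonzero integer vector.\<close>
  have "\<exists>s. int_act B1 (vector [s, 0]) \<in> ball w \<epsilon>"
  proof -
    have *: "\<bar>y / k\<bar> < \<epsilon>" if "k \<noteq> 0" for k :: int
    proof -
      have "1 \<le> \<bar>real_of_int k\<bar>"
        using that by linarith
      then have "\<bar>y / k\<bar> \<le> \<bar>y\<bar>"
        using mult_left_mono[of 1 "\<bar>real_of_int k\<bar>" "\<bar>y\<bar>"] by (simp add: abs_divide divide_le_eq)
      then show ?thesis
        using y by simp
    qed
    show ?thesis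
    proof (cases "d = 0")
      case False
      \<comment> \<open>\<open>B1\<close> sends (s, 0) to (d s, -c s). This s matches the first
        coordinate of w, and the second one is then off by y / d. If d = 0, the second coordinate is
        matched instead.\<close>
      have "dist w (int_act B1 (vector [w$1 / d, 0])) \<le> \<bar>y / d\<bar>"
        using False norm_le_components[of "w - int_act B1 (vector [w$1 / d, 0])"]
        by (simp add: dist_norm B1_def int_act_mat2 y_def field_simps)
      then show ?thesis
        using *[OF False] by (intro exI[of _ "w$1 / d"]) simp
    next
      case True
      then have c: "c \<noteq> 0"
        using det by auto
      have "dist w (int_act B1 (vector [- w$2 / c, 0])) \<le> \<bar>y / c\<bar>"
        using c True norm_le_components[of "w - int_act B1 (vector [- w$2 / c, 0])"]
        by (simp add: dist_norm B1_def int_act_mat2 y_def field_simps)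
      then show ?thesis
        using *[OF c] by (intro exI[of _ "- w$2 / c"]) simp
    qed
  qed
  then obtain s where s: "int_act B1 (vector [s, 0]) \<in> W"
    using \<epsilon>(2) by blast
  have "open (int_act B1 -` W)"
    using continuous_int_act \<open>open W\<close> by (rule open_vimage[rotated])
  then obtain \<delta> where \<delta>: "\<delta> > 0" "ball (vector [s, 0]) \<delta> \<subseteq> int_act B1 -` W"
    using s open_contains_ball by blast
  \<comment> \<open>Half of \<delta>, because after the shear the point differs from (s, 0) by at
    most |u_2| in each of the two coordinates.\<close>
  obtain C where C: "C \<in> Gamma2" "\<bar>int_act C v $ 2\<bar> < \<delta> / 2"
    using orbit_small[OF v, of "\<delta> / 2"] \<delta>(1) by auto
  define u where "u = int_act C v"
  have "u$2 \<noteq> 0"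
    using irrational_slopeD irrational_slope_int_act C v unfolding u_def by blast
  then obtain k :: int where k: "\<bar>(s - u$1) - 2 * k * u$2\<bar> \<le> \<bar>u$2\<bar>"
    using round_multiple by blast
  have "dist (vector [s, 0]) (int_act (mat2 1 (2 * k) 0 1) u) < \<delta>"
    using norm_le_components[of "vector [s, 0] - int_act (mat2 1 (2 * k) 0 1) u"] k C(2)
    by (simp add: dist_norm int_act_mat2 u_def algebra_simps)
  then have "int_act B1 (int_act (mat2 1 (2 * k) 0 1) u) \<in> W"
    using \<delta>(2) by auto
  then have "int_act (B1 ** (mat2 1 (2 * k) 0 1 ** C)) v \<in> W"
    by (simp add: int_act_mult u_def)
  then show thesis
    using that Gamma2_mult B1 C(1) Gamma2_upper by blast
qed

section \<open>Hexagons\<close>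

lemma exp_half_pi_i: "exp (complex_of_real (pi / 2) * \<i>) = \<i>"
  by (metis cis_conv_exp cis_pi_half mult.commute)

lemma tanh_surj_real:
  fixes r :: real
  assumes "\<bar>r\<bar> < 1"
  obtains t where "tanh t = r"
proof
  define E where "E = exp (- 2 * artanh r)"
  have "E = (1 - r) / (1 + r)"
    using assms by (simp add: E_def artanh_def exp_minus)
  then have "1 - E = r * (1 + E)"
    using assms by (simp add: field_simps)
  moreover have "1 + E \<noteq> 0"
    using exp_gt_zero[of "- 2 * artanh r"] by (simp add: E_def add_nonneg_eq_0_iff)
  ultimately show "tanh (artanh r) = r"
    unfolding tanh_real_altdef E_def[symmetric] by simp
qed

lemma continuous_map_pair_euclidean:
  assumes "continuous_map X euclidean f" "continuous_map X euclidean g"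
  shows "continuous_map X euclidean (\<lambda>x. (f x, g x))"
  using continuous_map_pairedI[OF assms] by simp

lemma continuous_map_compose_continuous_on:
  assumes f: "continuous_map X euclidean f" and h: "continuous_on A h"
    and "\<And>x. x \<in> topspace X \<Longrightarrow> f x \<in> A"
  shows "continuous_map X euclidean (\<lambda>x. h (f x))"
proof -
  have "continuous_map X (top_of_set A) f"
    using assms by (auto simp: continuous_map_in_subtopology)
  then show ?thesis
    using continuous_map_compose[of X "top_of_set A" f euclidean h] h by (simp add: o_def)
qed

lemma pm_class_eq_iff: "pm_class v = pm_class w \<longleftrightarrow> v = w \<or> v = - w"
  unfolding pm_class_def by (auto simp: doubleton_eq_iff)

lemma topspace_plane_mod_pm: "topspace plane_mod_pm = range pm_class"
  by (simp add: plane_mod_pm_def)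

lemma quotient_map_pm_class: "quotient_map euclidean plane_mod_pm pm_class"
  unfolding plane_mod_pm_def by (rule quotient_map_quotient_topology)

text \<open>An orthonormal basis turns the form into |z|^2 - |w|^2 and \<open>BV\<close> into the
  unit disc of quotients w / z, where everything can be computed. The final statement does not
  mention the basis.\<close>

locale hermitian_basis = hermitian_plane scale form
  for scale :: "complex \<Rightarrow> 'v::ab_group_add \<Rightarrow> 'v" and form +
  fixes e f :: 'v
  assumes form_ee: "form e e = 1" and form_ff: "form f f = - 1" and form_ef: "form e f = 0"
begin

abbreviation vec :: "complex \<Rightarrow> complex \<Rightarrow> 'v"
  where "vec z w \<equiv> scale z e + scale w f"

lemma form_add_right: "form x (y + z) = form x y + form x z"
  by (metis complex_cnj_add form_add form_hermitian)

lemma form_scale_right: "form x (scale a z) = cnj a * form x z"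
  by (metis complex_cnj_mult form_scale form_hermitian)

lemma form_fe: "form f e = 0"
  by (metis complex_cnj_zero form_ef form_hermitian)

lemma form_vec: "form (vec z w) (vec z' w') = z * cnj z' - w * cnj w'"
  by (simp add: form_add form_add_right form_scale form_scale_right form_ee form_ff form_ef form_fe)

lemma form_0_left [simp]: "form 0 x = 0"
  using form_scale[of 0 0 x] by simp

lemma coordinates: "form (vec z w) e = z" "form (vec z w) f = - w"
  using form_vec[of z w 1 0] form_vec[of z w 0 1] by simp_all

lemma vec_eq_vec_iff: "vec z w = vec z' w' \<longleftrightarrow> z = z' \<and> w = w'"
  using coordinates by (metis neg_equal_iff_equal)

lemma vec_eq_0_iff: "vec z w = 0 \<longleftrightarrow> z = 0 \<and> w = 0"
  using vec_eq_vec_iff[of z w 0 0] by simp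

lemma scale_vec: "scale a (vec z w) = vec (a * z) (a * w)"
  by (simp add: scale_right_distrib)

lemma add_vec: "vec z w + vec z' w' = vec (z + z') (w + w')"
  by (simp add: scale_left_distrib)

lemma diff_vec: "vec z w - vec z' w' = vec (z - z') (w - w')"
  by (simp add: scale_left_diff_distrib)

text \<open>A vector outside the span would extend {e, f} to three independent vectors, against
  \<open>dim_2\<close>.\<close>

lemma span_ef: "span {e, f} = UNIV"
proof -
  have ne: "e \<noteq> f"
    using form_ee form_ef by auto
  have ind: "independent {e, f}"
  proof -
    have "f \<noteq> 0"
      using form_ff form_0_left by force
    moreover have "e \<notin> span {f}"
    proof
      assume "e \<in> span {f}"
      then obtain a where "e = scale a f"
        by (auto simp: span_singleton)
      then have "vec 1 0 = vec 0 a"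
        by simp
      then show False
        unfolding vec_eq_vec_iff by simp
    qed
    ultimately show ?thesis
      using ne by (simp add: independent_insert)
  qed
  obtain B where B: "independent B" "span B = UNIV" "card B = 2"
    using basis_exists[of UNIV] dim_2 by (metis top.extremum_uniqueI)
  then have fin: "finite B"
    using card.infinite by force
  show ?thesis
  proof (rule ccontr)
    assume "span {e, f} \<noteq> UNIV"
    then obtain x where x: "x \<notin> span {e, f}"
      by blast
    then have "independent {x, e, f}"
      using ind by (metis independent_insertI)
    then have "card {x, e, f} \<le> card B"
      using independent_span_bound[OF fin, of "{x, e, f}"] B(2) by simp
    moreover have "x \<noteq> e" "x \<noteq> f"
      using x span_base by auto
    ultimately show False
      using ne B(3) by simp
  qed
qed

lemma vec_cases: obtains z w where "v = vec z w"
proof -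
  have "v \<in> span {e, f}"
    by (simp add: span_ef)
  then obtain a where "v - scale a e \<in> span {f}"
    using span_breakdown_eq by blast
  then obtain b where "v - scale a e = scale b f"
    by (auto simp: span_singleton)
  then show thesis
    by (metis that diff_add_cancel add.commute)
qed

subsection \<open>Lines\<close>

lemma span_vec: "span {vec z w} = {vec (a * z) (a * w) | a. True}"
  by (auto simp: span_singleton scale_vec)

lemma span_vec_eq_iff:
  assumes "z \<noteq> 0 \<or> w \<noteq> 0" "z' \<noteq> 0 \<or> w' \<noteq> 0"
  shows "span {vec z w} = span {vec z' w'} \<longleftrightarrow> z * w' = z' * w"
proof
  assume "span {vec z w} = span {vec z' w'}"
  then have "vec z w \<in> span {vec z' w'}"
    using span_base by blast
  then show "z * w' = z' * w"
    by (auto simp: span_vec vec_eq_vec_iff)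
next
  assume *: "z * w' = z' * w"
  have "\<exists>b. b \<noteq> 0 \<and> z' = b * z \<and> w' = b * w"
  proof (cases "z = 0")
    case True
    then show ?thesis
      using * assms by (intro exI[of _ "w' / w"]) auto
  next
    case False
    then show ?thesis
      using * assms by (intro exI[of _ "z' / z"]) (auto simp: field_simps)
  qed
  then obtain b where b: "b \<noteq> 0" "z' = b * z" "w' = b * w"
    by blast
  have "vec z' w' = scale b (vec z w)"
    by (simp only: b scale_vec)
  then show "span {vec z w} = span {vec z' w'}"
    using span_image_scale[of "{vec z w}" "\<lambda>_. b"] b(1) by simp
qed

lemma span_vec_PV: "z \<noteq> 0 \<or> w \<noteq> 0 \<Longrightarrow> span {vec z w} \<in> PV"
  unfolding PV_def using vec_eq_0_iff by blast

text \<open>Positivity means |w| < |z|, so one may divide by z; this is the disc model.\<close>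

lemma BV_cases:
  assumes "p \<in> BV"
  obtains \<zeta> where "p = span {vec 1 \<zeta>}" "norm \<zeta> < 1"
proof -
  obtain v where v: "p = span {v}" "Re (form v v) > 0"
    using assms by (auto simp: BV_def)
  obtain z w where zw: "v = vec z w"
    using vec_cases .
  have "norm w ^ 2 < norm z ^ 2"
    using v(2) by (simp add: zw form_vec complex_mult_cnj cmod_power2)
  then have lt: "norm w < norm z"
    using norm_ge_zero power_less_imp_less_base by blast
  then have "z \<noteq> 0"
    by auto
  moreover from this have "p = span {vec 1 (w / z)}"
    unfolding v zw by (subst span_vec_eq_iff) auto
  moreover have "norm (w / z) < 1"
    using lt by (simp add: norm_divide divide_simps)
  ultimately show thesis
    using that by blast
qed

lemma Re_form_vec: "Re (form (vec z w) (vec z w)) = norm z ^ 2 - norm w ^ 2"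
  by (simp add: form_vec complex_mult_cnj cmod_power2)

lemma span_BV: "Re (form v v) > 0 \<Longrightarrow> span {v} \<in> BV"
  unfolding BV_def by blast

lemma BV_subset_PV: "BV \<subseteq> PV"
proof
  fix p assume "p \<in> BV"
  then obtain v where "p = span {v}" "Re (form v v) > 0"
    by (auto simp: BV_def)
  moreover from this have "v \<noteq> 0"
    by auto
  ultimately show "p \<in> PV"
    unfolding PV_def by blast
qed

section \<open>Unitary maps and their action on lines\<close>

lemma unitary_groupI:
  assumes "\<And>x y. g (x + y) = g x + g y" "\<And>a x. g (scale a x) = scale a (g x)" "bij g"
    and "\<And>x y. form (g x) (g y) = form x y"
  shows "g \<in> unitary_group"
  using assms vector_space_axioms by (simp add: unitary_group_def Vector_Spaces.linear_iff)

lemma unitary_groupD: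
  assumes "g \<in> unitary_group"
  shows "g (x + y) = g x + g y" "g (scale a x) = scale a (g x)" "bij g"
    "form (g x) (g y) = form x y"
  using assms by (simp_all add: unitary_group_def Vector_Spaces.linear_iff)

lemma unitary_id: "id \<in> unitary_group"
  by (rule unitary_groupI) auto

lemma unitary_comp: "g \<in> unitary_group \<Longrightarrow> h \<in> unitary_group \<Longrightarrow> g \<circ> h \<in> unitary_group"
  by (rule unitary_groupI) (simp_all add: unitary_groupD bij_comp)

lemma unitary_inv_apply:
  assumes "g \<in> unitary_group"
  shows "g (inv_into UNIV g x) = x" "inv_into UNIV g (g x) = x"
  using unitary_groupD(3)[OF assms] by (simp_all add: bij_is_surj surj_f_inv_f bij_is_inj inv_f_f)

lemma unitary_inv:
  assumes "g \<in> unitary_group"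
  shows "inv_into UNIV g \<in> unitary_group"
proof (rule unitary_groupI)
  note [simp] = unitary_inv_apply[OF assms]
  have inj: "x = y" if "g x = g y" for x y
    using that unitary_inv_apply(2)[OF assms] by metis
  show "inv_into UNIV g (x + y) = inv_into UNIV g x + inv_into UNIV g y" for x y
    by (rule inj) (simp add: unitary_groupD(1)[OF assms])
  show "inv_into UNIV g (scale a x) = scale a (inv_into UNIV g x)" for a x
    by (rule inj) (simp add: unitary_groupD(2)[OF assms])
  show "bij (inv_into UNIV g)"
    using assms unitary_groupD(3) bij_imp_bij_inv by blast
  show "form (inv_into UNIV g x) (inv_into UNIV g y) = form x y" for x y
    using unitary_groupD(4)[OF assms, of "inv_into UNIV g x" "inv_into UNIV g y"] by simp
qed

lemma unitary_image_inv:
  assumes "g \<in> unitary_group"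
  shows "g ` inv_into UNIV g ` p = p" "inv_into UNIV g ` g ` p = p"
  using unitary_inv_apply[OF assms] by (auto simp: image_image)

lemma unitary_span:
  assumes "g \<in> unitary_group"
  shows "g ` span {u} = span {g u}"
  by (auto simp: span_singleton unitary_groupD(2)[OF assms] image_iff)

lemma unitary_nonzero:
  assumes "g \<in> unitary_group" "u \<noteq> 0"
  shows "g u \<noteq> 0"
proof
  assume "g u = 0"
  moreover have "g 0 = 0"
    using unitary_groupD(2)[OF assms(1), of 0 0] by simp
  ultimately show False
    using assms unitary_inv_apply(2) by metis
qed

lemma unitary_PV: "g \<in> unitary_group \<Longrightarrow> p \<in> PV \<Longrightarrow> g ` p \<in> PV"
  unfolding PV_def using unitary_span unitary_nonzero by fast

lemma unitary_BV:
  assumes "g \<in> unitary_group" "p \<in> BV"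
  shows "g ` p \<in> BV"
proof -
  obtain u where "p = span {u}" "Re (form u u) > 0"
    using assms(2) by (auto simp: BV_def)
  then show ?thesis
    using unitary_span[OF assms(1)] span_BV[of "g u"] unitary_groupD(4)[OF assms(1)] by simp
qed

section \<open>Half-turns\<close>

abbreviation half_turn :: "'v set \<Rightarrow> 'v \<Rightarrow> 'v"
  where "half_turn c \<equiv> rotation c \<i>"

text \<open>For k = \<i> the coefficient \<open>cnj k - k\<close> is -2 \<i>, so the half-turn is
  \<i> times the reflection that negates u. The representative picked by \<open>SOME\<close> is a
  multiple of u, and the factor cancels.\<close>

lemma half_turn_span:
  assumes "form u u \<noteq> 0"
  shows "half_turn (span {u}) p = scale \<i> (p - scale (2 * form p u / form u u) u)"
proof -
  define v where "v = (SOME v. v \<in> span {u} \<and> v \<noteq> 0)"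
  have "u \<in> span {u} \<and> u \<noteq> 0"
    using assms span_base by auto
  then have "v \<in> span {u} \<and> v \<noteq> 0"
    unfolding v_def by (rule someI)
  then obtain a where a: "v = scale a u" "a \<noteq> 0"
    by (auto simp: span_singleton)
  have "scale (form p v / form v v) v = scale (form p u / form u u) u"
    using a by (simp add: form_scale form_scale_right)
  then have "scale ((cnj \<i> - \<i>) * (form p v / form v v)) v = scale (- 2 * \<i>) (scale (form p u / form u u) u)"
    by (metis complex_cnj_i minus_mult_minus mult_2 mult_minus_left scale_scale
        add_uminus_conv_diff minus_add_distrib)
  then show ?thesis
    unfolding rotation_def Let_def v_def[symmetric]
    by (simp add: scale_right_diff_distrib algebra_simps)
qed

lemma BV_rep:
  assumes "c \<in> BV"
  obtains u where "c = span {u}" "form u u \<noteq> 0" "Re (form u u) > 0"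
proof -
  obtain u where "c = span {u}" "Re (form u u) > 0"
    using assms by (auto simp: BV_def)
  moreover from this have "form u u \<noteq> 0"
    by auto
  ultimately show thesis
    using that by blast
qed

lemma form_diff_left: "form (x - y) z = form x z - form y z"
  using form_add[of "x - y" y z] by simp

lemma form_diff_right: "form x (y - z) = form x y - form x z"
  using form_add_right[of x "y - z" z] by simp

lemma half_turn_form:
  assumes "form u u \<noteq> 0"
  shows "form (half_turn (span {u}) p) u = - \<i> * form p u"
  using assms by (simp add: half_turn_span form_scale form_diff_left)

text \<open>The reflection is an involution and the factor \<i> squares to -1. The sign disappears
  only on lines, see \<open>half_turn_image_image\<close>.\<close>

lemma half_turn_half_turn:
  assumes "c \<in> BV"
  shows "half_turn c (half_turn c p) = - p"
proof -
  obtain u where u: "c = span {u}" "form u u \<noteq> 0"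
    using assms BV_rep by blast
  define b where "b = 2 * form p u / form u u"
  have q: "half_turn c p = scale \<i> (p - scale b u)"
    by (simp add: u half_turn_span b_def)
  have "2 * form (half_turn c p) u / form u u = - \<i> * b"
    using half_turn_form[OF u(2), of p] by (simp add: u(1) b_def)
  then have "half_turn c (half_turn c p) = scale \<i> (half_turn c p - scale (- \<i> * b) u)"
    using half_turn_span[OF u(2), of "half_turn c p"] by (simp add: u(1))
  then show ?thesis
    unfolding q by (simp add: scale_right_diff_distrib scale_right_distrib)
qed

lemma half_turn_unitary:
  assumes "c \<in> BV"
  shows "half_turn c \<in> unitary_group"
proof -
  obtain u where u: "c = span {u}" "form u u \<noteq> 0"
    using assms BV_rep by blast
  note ht = half_turn_span[OF u(2), folded u(1)]
  show ?thesis
  proof (rule unitary_groupI)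
    show add: "half_turn c (x + y) = half_turn c x + half_turn c y" for x y
      by (simp add: ht form_add add_divide_distrib ring_distribs scale_left_distrib scale_right_distrib
          scale_right_diff_distrib algebra_simps)
    show scale: "half_turn c (scale a x) = scale a (half_turn c x)" for a x
      by (simp add: ht form_scale scale_right_diff_distrib mult_ac)
    have neg: "half_turn c (- x) = - half_turn c x" for x
      using scale[of "-1" x] by simp
    show "bij (half_turn c)"
    proof (rule bijI')
      show "half_turn c x = half_turn c y \<longleftrightarrow> x = y" for x y
        using half_turn_half_turn[OF assms] neg_equal_iff_equal by metis
      show "\<exists>x. y = half_turn c x" for y
        using half_turn_half_turn[OF assms, of y] neg minus_minus by metis
    qed
    have real: "cnj (form u u) = form u u"
      using form_hermitian by metis
    have "form (x - scale (2 * form x u / form u u) u) (y - scale (2 * form y u / form u u) u) = form x y"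
      for x y
    proof -
      have "cnj (form y u) = form u y"
        using form_hermitian by metis
      then show ?thesis
        using u(2) by (simp add: form_diff_left form_diff_right form_scale form_scale_right real)
    qed
    then show "form (half_turn c x) (half_turn c y) = form x y" for x y
      by (simp add: ht form_scale form_scale_right)
  qed
qed

lemma half_turn_equivariant:
  assumes "g \<in> unitary_group" "c \<in> BV"
  shows "half_turn (g ` c) (g p) = g (half_turn c p)"
proof -
  obtain u where u: "c = span {u}" "form u u \<noteq> 0"
    using assms(2) BV_rep by blast
  have diff: "g (x - y) = g x - g y" for x y
    using unitary_groupD(1)[OF assms(1), of "x - y" y] by simp
  have "form (g u) (g u) \<noteq> 0"
    using u(2) unitary_groupD(4)[OF assms(1)] by simp
  then show ?thesis
    unfolding u(1) unitary_span[OF assms(1)]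
    by (simp add: half_turn_span u(2) unitary_groupD[OF assms(1)] diff)
qed

lemma half_turn_vec:
  assumes "form (vec a b) (vec a b) = 1"
  shows "half_turn (span {vec a b}) (vec z w)
    = scale \<i> (vec (z - 2 * (z * cnj a - w * cnj b) * a) (w - 2 * (z * cnj a - w * cnj b) * b))"
proof -
  have "form (vec a b) (vec a b) \<noteq> 0"
    unfolding assms by simp
  note half_turn_span[OF this, unfolded assms div_by_1]
  then show ?thesis
    by (simp only: form_vec scale_vec diff_vec)
qed

lemma half_turn_image_image:
  assumes "c \<in> BV" "p \<in> PV"
  shows "half_turn c ` half_turn c ` p = p"
proof -
  obtain v where v: "p = span {v}"
    using assms(2) by (auto simp: PV_def)
  note g = half_turn_unitary[OF assms(1)]
  show ?thesis
    unfolding v unitary_span[OF g] half_turn_half_turn[OF assms(1)]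
    using span_image_scale[of "{v}" "\<lambda>_. -1"] by simp
qed

lemma half_turn_fixes:
  assumes "c \<in> BV"
  shows "half_turn c ` c = c"
proof -
  obtain u where u: "c = span {u}" "form u u \<noteq> 0"
    using assms BV_rep by blast
  have "half_turn c u = scale (- \<i>) u"
  proof -
    have "u - scale 2 u = - u"
      using scale_left_diff_distrib[of 1 2 u] by simp
    then show ?thesis
      using u by (simp add: half_turn_span)
  qed
  then show ?thesis
    using unitary_span[OF half_turn_unitary[OF assms], of u] u(1)
      span_image_scale[of "{u}" "\<lambda>_. - \<i>"] by simp
qed

text \<open>On disc representatives the form is 1 minus a product of two numbers of modulus below
  1.\<close>

lemma BV_not_orthogonal:
  assumes "span {u} \<in> BV" "span {v} \<in> BV"
  shows "form u v \<noteq> 0"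
proof -
  obtain \<zeta> where \<zeta>: "span {u} = span {vec 1 \<zeta>}" "norm \<zeta> < 1"
    using BV_cases assms(1) by blast
  obtain \<eta> where \<eta>: "span {v} = span {vec 1 \<eta>}" "norm \<eta> < 1"
    using BV_cases assms(2) by blast
  obtain a where a: "vec 1 \<zeta> = scale a u"
    using \<zeta>(1) span_base[of "vec 1 \<zeta>" "{vec 1 \<zeta>}"] by (auto simp: span_singleton)
  obtain b where b: "vec 1 \<eta> = scale b v"
    using \<eta>(1) span_base[of "vec 1 \<eta>" "{vec 1 \<eta>}"] by (auto simp: span_singleton)
  have "norm (\<zeta> * cnj \<eta>) < 1"
    using mult_strict_mono'[OF \<zeta>(2) \<eta>(2)] by (simp add: norm_mult)
  then have "form (vec 1 \<zeta>) (vec 1 \<eta>) \<noteq> 0"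
    unfolding form_vec by auto
  then show ?thesis
    unfolding a b by (auto simp: form_scale form_scale_right)
qed

text \<open>An invariant line of the half-turn about u is spanned by u or orthogonal to u, and
  \<open>BV_not_orthogonal\<close> rules out the second possibility. This makes the
  \<open>THE\<close> in \<open>fixed_point\<close> well defined for half-turns.\<close>

lemma half_turn_fixed_unique:
  assumes c: "c \<in> BV" and p: "p \<in> BV" and fixed: "half_turn c ` p = p"
  shows "p = c"
proof -
  obtain u where u: "c = span {u}" "form u u \<noteq> 0"
    using c BV_rep by blast
  obtain v where v: "p = span {v}" "form v v \<noteq> 0"
    using p BV_rep by blast
  have "half_turn c v \<in> span {v}"
    using fixed v(1) span_base[of v "{v}"] by blast
  then obtain a where a: "half_turn c v = scale a v"
    by (auto simp: span_singleton)
  define b where "b = 2 * form v u / form u u"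
  have b: "b \<noteq> 0"
    using BV_not_orthogonal[of v u] c p u v by (simp add: b_def)
  have "scale (\<i> * b) u = scale (\<i> - a) v"
    using a by (simp add: u half_turn_span b_def scale_left_diff_distrib scale_right_diff_distrib algebra_simps)
  moreover have "scale (\<i> * b) u \<noteq> 0"
    using b u(2) by auto
  ultimately have "span {u} = span {v}"
    using span_image_scale[of "{u}" "\<lambda>_. \<i> * b"] span_image_scale[of "{v}" "\<lambda>_. \<i> - a"] b by auto
  then show ?thesis
    using u v by simp
qed

lemma fixed_point_half_turn:
  assumes "c \<in> BV"
  shows "fixed_point (half_turn c) = c"
  unfolding fixed_point_def
  using assms half_turn_fixes half_turn_fixed_unique by (intro the_equality) auto

lemma conjugate_half_turn:
  assumes "g \<in> unitary_group" "c \<in> BV"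
  shows "conjugate (half_turn c) g = half_turn (g ` c)"
proof
  fix x
  show "conjugate (half_turn c) g x = half_turn (g ` c) x"
    using half_turn_equivariant[OF assms, of "inv_into UNIV g x"]
    by (simp add: conjugate_def unitary_inv_apply[OF assms(1)])
qed

lemma inv_half_turn_image:
  assumes "c \<in> BV" "p \<in> PV"
  shows "inv_into UNIV (half_turn c) ` p = half_turn c ` p"
  using unitary_image_inv(2)[OF half_turn_unitary[OF assms(1)], of "half_turn c ` p"]
    half_turn_image_image[OF assms] by simp

text \<open>Conjugating by a half-turn or by its inverse moves the center to the same point, since
  the two agree on lines. For this reason the modifications of both types obey the same
  formulas.\<close>

lemma fixed_point_conjugate:
  assumes "c \<in> BV" "d \<in> BV"
  shows "fixed_point (conjugate (half_turn d) (half_turn c)) = half_turn c ` d"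
    and "fixed_point (conjugate (half_turn d) (inv_into UNIV (half_turn c))) = half_turn c ` d"
proof -
  note g = half_turn_unitary[OF assms(1)]
  show "fixed_point (conjugate (half_turn d) (half_turn c)) = half_turn c ` d"
    by (simp add: conjugate_half_turn[OF g assms(2)] fixed_point_half_turn unitary_BV[OF g assms(2)])
  have "inv_into UNIV (half_turn c) ` d = half_turn c ` d"
    using assms BV_subset_PV inv_half_turn_image by blast
  then show "fixed_point (conjugate (half_turn d) (inv_into UNIV (half_turn c))) = half_turn c ` d"
    by (metis conjugate_half_turn[OF unitary_inv[OF g] assms(2)] fixed_point_half_turn unitary_BV[OF g assms(2)])
qed

lemma rotations_half_pi:
  "rotations (pi / 2) (pi / 2) (pi / 2) (pi / 2) (c0, c1, c2, c3)
    = (half_turn c0, half_turn c1, half_turn c2, half_turn c3)"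
  by (simp only: rotations_def exp_half_pi_i prod.case)

lemma modify_quad_half_pi:
  assumes "c0 \<in> BV" "c1 \<in> BV" "c2 \<in> BV" "c3 \<in> BV"
  shows "modify_quad (factors1 ty) (pi / 2) (pi / 2) (pi / 2) (pi / 2) (c0, c1, c2, c3)
      = (half_turn c3 ` c0, c1, half_turn c1 ` c2, c3)"
    and "modify_quad (factors2 ty) (pi / 2) (pi / 2) (pi / 2) (pi / 2) (c0, c1, c2, c3)
      = (half_turn c3 ` c0, half_turn c2 ` c1, c2, c3)"
    and "modify_quad (factors3 ty) (pi / 2) (pi / 2) (pi / 2) (pi / 2) (c0, c1, c2, c3)
      = (half_turn c1 ` c0, c1, half_turn c3 ` c2, c3)"
  by (cases ty; simp only: modify_quad_def rotations_half_pi factors1.simps factors2.simps factors3.simps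
      prod.case fixed_point_half_turn fixed_point_conjugate assms)+

section \<open>The standard geodesic and isometries that bring points to it\<close>

definition geodesic_point :: "real \<Rightarrow> 'v set"
  where "geodesic_point t = span {vec (of_real (cosh t)) (of_real (sinh t))}"

text \<open>The chosen representatives have norm 1 and form the hyperbolic cosine of the parameter
  difference, so t is arc length along the real diameter of the disc.\<close>

lemma form_cosh_sinh:
  "form (vec (of_real (cosh s)) (of_real (sinh s))) (vec (of_real (cosh t)) (of_real (sinh t)))
    = of_real (cosh (s - t))"
  by (simp add: form_vec cosh_diff)

lemma geodesic_point_BV: "geodesic_point t \<in> BV"
  unfolding geodesic_point_def by (rule span_BV) (simp add: form_cosh_sinh)

lemma geodesic_point_PV: "geodesic_point t \<in> PV"
  using geodesic_point_BV BV_subset_PV by blast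

lemma geodesic_point_tanh: "geodesic_point t = span {vec 1 (of_real (tanh t))}"
proof -
  have "cosh t \<noteq> 0"
    by simp
  then have "complex_of_real (cosh t) \<noteq> 0"
    unfolding of_real_eq_0_iff .
  then show ?thesis
    unfolding geodesic_point_def by (subst span_vec_eq_iff) (auto simp: tanh_def)
qed

lemma half_turn_geodesic_vec:
  "half_turn (geodesic_point t) (vec z w) = scale \<i>
    (vec (of_real (sinh (2 * t)) * w - of_real (cosh (2 * t)) * z)
         (of_real (cosh (2 * t)) * w - of_real (sinh (2 * t)) * z))"
proof -
  define C where "C = complex_of_real (cosh t)"
  define D where "D = complex_of_real (sinh t)"
  have CD: "C * C = D * D + 1"
    unfolding C_def D_def using cosh_square_eq[of t]
    by (metis of_real_1 of_real_add of_real_mult power2_eq_square)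
  have dbl: "of_real (cosh (2 * t)) = C * C + D * D" "of_real (sinh (2 * t)) = 2 * D * C"
    by (simp_all add: C_def D_def cosh_double sinh_double power2_eq_square)
  have c: "cnj C = C" "cnj D = D"
    by (simp_all add: C_def D_def)
  have 1: "form (vec C D) (vec C D) = 1"
    unfolding C_def D_def form_cosh_sinh by simp
  have "z - 2 * (z * C - w * D) * C = 2 * D * C * w - (C * C + D * D) * z"
    "w - 2 * (z * C - w * D) * D = (C * C + D * D) * w - 2 * D * C * z"
    using CD by algebra+
  then show ?thesis
    using half_turn_vec[OF 1, of z w] unfolding c geodesic_point_def dbl C_def[symmetric] D_def[symmetric]
    by simp
qed

lemma half_turn_geodesic_geodesic:
  "half_turn (geodesic_point s) ` geodesic_point t = geodesic_point (2 * s - t)"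
proof -
  have "half_turn (geodesic_point s) (vec (of_real (cosh t)) (of_real (sinh t)))
      = scale (- \<i>) (vec (of_real (cosh (2 * s - t))) (of_real (sinh (2 * s - t))))"
    unfolding half_turn_geodesic_vec scale_vec vec_eq_vec_iff cosh_diff sinh_diff
    by (simp add: algebra_simps)
  then show ?thesis
    using unitary_span[OF half_turn_unitary[OF geodesic_point_BV[of s]]]
      span_image_scale[of "{vec (of_real (cosh (2 * s - t))) (of_real (sinh (2 * s - t)))}" "\<lambda>_. - \<i>"]
    by (simp add: geodesic_point_def)
qed

text \<open>Up to the factor -1, this is the hyperbolic rotation matrix of the translation by 2 (s -
  t).\<close>

lemma half_turn_half_turn_geodesic_vec:
  "half_turn (geodesic_point s) (half_turn (geodesic_point t) (vec z w)) = scale (- 1)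
    (vec (of_real (cosh (2 * (s - t))) * z + of_real (sinh (2 * (s - t))) * w)
         (of_real (sinh (2 * (s - t))) * z + of_real (cosh (2 * (s - t))) * w))"
  unfolding half_turn_geodesic_vec scale_vec vec_eq_vec_iff right_diff_distrib[of 2] cosh_diff sinh_diff
  by (simp add: algebra_simps)

lemma rotation_about_origin:
  assumes "norm \<mu> = 1"
  obtains g where "g \<in> unitary_group" "\<And>z w. g (vec z w) = vec z (\<mu> * w)"
proof
  define g where "g v = vec (form v e) (\<mu> * (- form v f))" for v
  show g: "g (vec z w) = vec z (\<mu> * w)" for z w
    unfolding g_def coordinates by simp
  have \<mu>: "\<mu> * cnj \<mu> = 1"
    using assms complex_norm_square[of \<mu>] by simp
  show "g \<in> unitary_group"
  proof (rule unitary_groupI)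
    fix x y a
    obtain z w where x: "x = vec z w"
      using vec_cases .
    obtain z' w' where y: "y = vec z' w'"
      using vec_cases .
    show "g (x + y) = g x + g y"
      unfolding x y add_vec g vec_eq_vec_iff by (simp add: algebra_simps)
    show "g (scale a x) = scale a (g x)"
      unfolding x scale_vec g vec_eq_vec_iff by simp
    show "form (g x) (g y) = form x y"
      unfolding x y form_vec g using \<mu> by (simp add: mult.left_commute mult.assoc)
  next
    show "bij g"
    proof (rule bijI')
      show "g x = g y \<longleftrightarrow> x = y" for x y
      proof -
        obtain z w where x: "x = vec z w"
          using vec_cases .
        obtain z' w' where y: "y = vec z' w'"
          using vec_cases .
        show ?thesis
          unfolding x y g vec_eq_vec_iff using assms by auto
      qed
      show "\<exists>x. y = g x" for y
      proof -
        obtain z w where y: "y = vec z w"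
          using vec_cases .
        have "y = g (vec z (cnj \<mu> * w))"
          unfolding y g vec_eq_vec_iff using \<mu> by simp
        then show ?thesis ..
      qed
    qed
  qed
qed

lemma rotate_to_geodesic:
  assumes "c \<in> BV"
  obtains g t where "g \<in> unitary_group" "g ` c = geodesic_point t" "g ` geodesic_point 0 = geodesic_point 0"
proof -
  obtain \<zeta> where \<zeta>: "c = span {vec 1 \<zeta>}" "norm \<zeta> < 1"
    using BV_cases assms by blast
  obtain t where t: "tanh t = norm \<zeta>"
    using tanh_surj_real[of "norm \<zeta>"] \<zeta>(2) by auto
  \<comment> \<open>Multiplication by this unit number turns \<zeta> to its modulus. If \<zeta> = 0,
    any unit number would do.\<close>
  define \<mu> where "\<mu> = (if \<zeta> = 0 then 1 else cnj \<zeta> / norm \<zeta>)"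
  have "norm \<mu> = 1"
    by (simp add: \<mu>_def norm_divide)
  then obtain g where g: "g \<in> unitary_group" "\<And>z w. g (vec z w) = vec z (\<mu> * w)"
    using rotation_about_origin by blast
  have "\<mu> * \<zeta> = of_real (norm \<zeta>)"
    using complex_norm_square[of \<zeta>]
    by (cases "\<zeta> = 0") (simp_all add: \<mu>_def power2_eq_square mult.commute nonzero_divide_eq_eq)
  then have "g ` c = geodesic_point t"
    unfolding \<zeta>(1) unitary_span[OF g(1)] geodesic_point_tanh t g(2) by simp
  moreover have "g ` geodesic_point 0 = geodesic_point 0"
    unfolding geodesic_point_tanh unitary_span[OF g(1)] g(2) by simp
  ultimately show thesis
    using that g(1) by blast
qed

lemma translation_along_geodesic:
  obtains g where "g \<in> unitary_group" "\<And>t. g ` geodesic_point t = geodesic_point (t + s)"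
proof
  \<comment> \<open>Two half-turns whose centers are s / 2 apart compose to the translation by s: t
    goes to -t and then to s + t.\<close>
  let ?g = "half_turn (geodesic_point (s / 2)) \<circ> half_turn (geodesic_point 0)"
  show "?g \<in> unitary_group"
    by (intro unitary_comp half_turn_unitary geodesic_point_BV)
  show "?g ` geodesic_point t = geodesic_point (t + s)" for t
    unfolding image_comp[symmetric] half_turn_geodesic_geodesic by (simp add: add.commute)
qed

subsection \<open>Classification of the quadrangles\<close>

lemma half_turns_equivariant:
  assumes g: "g \<in> unitary_group" and c: "c \<in> BV"
  shows "half_turn (g ` c) ` g ` p = g ` half_turn c ` p"
  using half_turn_equivariant[OF g c] by (simp add: image_image)

definition closing :: "'v set quad \<Rightarrow> bool"
  where "closing = (\<lambda>(c0, c1, c2, c3). c0 \<in> BV \<and> c1 \<in> BV \<and> c2 \<in> BV \<and> c3 \<in> BV \<and>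
    (\<forall>p\<in>PV. half_turn c3 ` half_turn c2 ` half_turn c1 ` half_turn c0 ` p = p))"

text \<open>Reversing a product of involutions inverts it, so on lines the relations of the two
  types are equivalent and \<open>closing\<close> serves for both.\<close>

lemma hexagon_quads_half_pi:
  "hexagon_quads ty (pi / 2) (pi / 2) (pi / 2) (pi / 2) = {c. closing c}"
proof -
  have "closing (c0, c1, c2, c3) \<longleftrightarrow> c0 \<in> BV \<and> c1 \<in> BV \<and> c2 \<in> BV \<and> c3 \<in> BV \<and>
    (\<forall>p\<in>PV. half_turn c0 ` half_turn c1 ` half_turn c2 ` half_turn c3 ` p = p)" (is "_ \<longleftrightarrow> ?r c0 c1 c2 c3")
    for c0 c1 c2 c3
  proof -
    have "?r c3 c2 c1 c0" if r: "?r c0 c1 c2 c3" for c0 c1 c2 c3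
    proof -
      have *: "half_turn c3 ` half_turn c2 ` half_turn c1 ` half_turn c0 ` p = p" if p: "p \<in> PV" for p
      proof -
        have BV: "c0 \<in> BV" "c1 \<in> BV" "c2 \<in> BV" "c3 \<in> BV"
          using r by auto
        note [simp] = half_turn_image_image[OF BV(1)] half_turn_image_image[OF BV(2)]
          half_turn_image_image[OF BV(3)] half_turn_image_image[OF BV(4)] BV
          unitary_PV[OF half_turn_unitary]
        have "half_turn c0 ` half_turn c1 ` half_turn c2 ` half_turn c3 ` p = p"
          using r p by (elim conjE) (rule bspec)
        then have "half_turn c3 ` half_turn c2 ` half_turn c1 ` half_turn c0 ` p =
            half_turn c3 ` half_turn c2 ` half_turn c1 ` half_turn c0 `
              half_turn c0 ` half_turn c1 ` half_turn c2 ` half_turn c3 ` p"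
          by simp
        then show ?thesis
          using p by simp
      qed
      show ?thesis
        using r by (elim conjE, intro conjI ballI *)
    qed
    from this[of c0 c1 c2 c3] this[of c3 c2 c1 c0] have "?r c3 c2 c1 c0 \<longleftrightarrow> ?r c0 c1 c2 c3"
      by (rule iffI[rotated])
    then show ?thesis
      unfolding closing_def prod.case by (simp only: conj_ac)
  qed
  note rev = this
  have "c \<in> hexagon_quads First (pi / 2) (pi / 2) (pi / 2) (pi / 2) \<longleftrightarrow> closing c" for c
    by (cases c) (simp add: hexagon_quads_def rotations_half_pi trivial_in_PU_def closing_def image_image)
  moreover have "c \<in> hexagon_quads Second (pi / 2) (pi / 2) (pi / 2) (pi / 2) \<longleftrightarrow> closing c" for c
    by (cases c) (simp add: hexagon_quads_def rotations_half_pi trivial_in_PU_def rev image_image)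
  ultimately show ?thesis
    by (cases ty) auto
qed

lemma closing_image:
  assumes g: "g \<in> unitary_group" and "closing (c0, c1, c2, c3)"
  shows "closing (g ` c0, g ` c1, g ` c2, g ` c3)"
proof -
  have c: "c0 \<in> BV" "c1 \<in> BV" "c2 \<in> BV" "c3 \<in> BV"
    and eq: "\<And>p. p \<in> PV \<Longrightarrow> half_turn c3 ` half_turn c2 ` half_turn c1 ` half_turn c0 ` p = p"
    using assms(2) by (auto simp: closing_def)
  have "half_turn (g ` c3) ` half_turn (g ` c2) ` half_turn (g ` c1) ` half_turn (g ` c0) ` p = p"
    if "p \<in> PV" for p
  proof -
    define q where "q = inv_into UNIV g ` p"
    have q: "p = g ` q" "q \<in> PV"
      using that unitary_image_inv(1)[OF g] unitary_PV[OF unitary_inv[OF g]] by (simp_all add: q_def)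
    show ?thesis
      unfolding q(1) by (simp only: half_turns_equivariant[OF g] c eq[OF q(2)])
  qed
  then show ?thesis
    using c unitary_BV[OF g] by (simp add: closing_def)
qed

text \<open>The last position is forced by t_0 + t_2 = t_1 + t_3.\<close>

definition standard_quad :: "real \<Rightarrow> real \<Rightarrow> 'v set quad"
  where "standard_quad x y =
    (geodesic_point 0, geodesic_point x, geodesic_point (x + y), geodesic_point y)"

text \<open>The products R_1 R_0 and R_3 R_2 are translations by opposite amounts, and their two
  factors -1 cancel.\<close>

lemma closing_geodesic:
  assumes "t0 + t2 = t1 + t3"
  shows "closing (geodesic_point t0, geodesic_point t1, geodesic_point t2, geodesic_point t3)"
proof -
  have "half_turn (geodesic_point t3) ` half_turn (geodesic_point t2) ` half_turn (geodesic_point t1) `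
      half_turn (geodesic_point t0) ` p = p" if "p \<in> PV" for p
  proof -
    have eq: "2 * (t3 - t2) = - (2 * (t1 - t0))"
      using assms by simp
    define C D where "C = complex_of_real (cosh (2 * (t1 - t0)))"
      and "D = complex_of_real (sinh (2 * (t1 - t0)))"
    have CD: "C * C = D * D + 1"
      unfolding C_def D_def using cosh_square_eq[of "2 * (t1 - t0)"]
      by (metis of_real_1 of_real_add of_real_mult power2_eq_square)
    have "half_turn (geodesic_point t3) (half_turn (geodesic_point t2) (half_turn (geodesic_point t1)
      (half_turn (geodesic_point t0) (vec z w)))) = vec z w" for z w
      unfolding half_turn_half_turn_geodesic_vec scale_vec eq cosh_minus sinh_minus of_real_minus
        C_def[symmetric] D_def[symmetric] vec_eq_vec_iff
      using CD by (intro conjI) algebra+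
    then have "half_turn (geodesic_point t3) (half_turn (geodesic_point t2) (half_turn (geodesic_point t1)
      (half_turn (geodesic_point t0) v))) = v" for v
      using vec_cases by metis
    then show ?thesis
      by (simp add: image_image)
  qed
  then show ?thesis
    by (simp add: closing_def geodesic_point_BV)
qed

text \<open>In a closing quadrangle, the half-turn about the third center inverts the translation
  \<open>R\<^sub>1 R\<^sub>0\<close>, hence swaps its two fixed null lines; this puts the center on the axis.\<close>

lemma null_lines_swapped:
  assumes c: "c \<in> BV"
    and fixed: "half_turn (geodesic_point x) ` half_turn (geodesic_point 0) ` half_turn c ` span {vec 1 1}
      = half_turn c ` span {vec 1 1}"
    and "x \<noteq> 0"
  obtains s where "c = geodesic_point s"
proof -
  obtain \<zeta> where \<zeta>: "c = span {vec 1 \<zeta>}" "norm \<zeta> < 1"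
    using BV_cases c by blast
  define D where "D = 1 - \<zeta> * cnj \<zeta>"
  have "(norm \<zeta>)\<^sup>2 < 1"
    using \<zeta>(2) by (simp add: power_less_one_iff)
  then have D: "D \<noteq> 0"
    unfolding D_def using complex_norm_square[of \<zeta>]
    by (metis less_irrefl of_real_1 of_real_eq_iff right_minus_eq)
  have form: "form (vec 1 \<zeta>) (vec 1 \<zeta>) = D"
    unfolding form_vec D_def by simp
  define b where "b = 2 * (1 - cnj \<zeta>) / D"
  have z1: "\<zeta> \<noteq> 1"
    using \<zeta>(2) by auto
  have b0: "b \<noteq> 0"
    using z1 D by (simp add: b_def)
  define z w where "z = \<i> * (1 - b)" and "w = \<i> * (1 - b * \<zeta>)"
  have "half_turn c (vec 1 1) = scale \<i> (vec 1 1 - scale b (vec 1 \<zeta>))"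
  proof -
    have "form (vec 1 1) (vec 1 \<zeta>) = 1 - cnj \<zeta>"
      unfolding form_vec by simp
    moreover have "form (vec 1 \<zeta>) (vec 1 \<zeta>) \<noteq> 0"
      unfolding form by (rule D)
    ultimately show ?thesis
      using half_turn_span[of "vec 1 \<zeta>" "vec 1 1"] unfolding \<zeta>(1) form b_def by simp
  qed
  then have zw: "half_turn c (vec 1 1) = vec z w"
    unfolding scale_vec diff_vec z_def w_def by simp
  have ne: "z \<noteq> 0 \<or> w \<noteq> 0"
  proof -
    have "vec 1 1 \<noteq> 0"
      unfolding vec_eq_0_iff by simp
    then have "vec z w \<noteq> 0"
      unfolding zw[symmetric] by (rule unitary_nonzero[OF half_turn_unitary[OF c]])
    then show ?thesis
      unfolding vec_eq_0_iff by simp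
  qed
  define C' D' where "C' = complex_of_real (cosh (2 * x))" and "D' = complex_of_real (sinh (2 * x))"
  have xy: "half_turn (geodesic_point x) (half_turn (geodesic_point 0) (vec z w)) =
      vec (- (C' * z + D' * w)) (- (D' * z + C' * w))"
    unfolding half_turn_half_turn_geodesic_vec scale_vec C'_def D'_def by simp
  note gx = half_turn_unitary[OF geodesic_point_BV[of x]]
  note g0 = half_turn_unitary[OF geodesic_point_BV[of 0]]
  have "vec z w \<noteq> 0"
    unfolding vec_eq_0_iff using ne by simp
  then have "vec (- (C' * z + D' * w)) (- (D' * z + C' * w)) \<noteq> 0"
    unfolding xy[symmetric] by (intro unitary_nonzero[OF gx] unitary_nonzero[OF g0])
  then have ne': "- (C' * z + D' * w) \<noteq> 0 \<or> - (D' * z + C' * w) \<noteq> 0"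
    unfolding vec_eq_0_iff by simp
  have "span {vec (- (C' * z + D' * w)) (- (D' * z + C' * w))} = span {vec z w}"
    using fixed unfolding unitary_span[OF half_turn_unitary[OF c]] zw unitary_span[OF g0]
      unitary_span[OF gx] xy .
  then have "- (C' * z + D' * w) * w = z * - (D' * z + C' * w)"
    unfolding span_vec_eq_iff[OF ne' ne] .
  \<comment> \<open>A nontrivial translation along the axis preserves only the two null lines z = w
    and z = -w.\<close>
  then have "D' * ((z - w) * (z + w)) = 0"
    by algebra
  moreover have "D' \<noteq> 0"
    using \<open>x \<noteq> 0\<close> by (simp add: D'_def)
  ultimately have "z = w \<or> z + w = 0"
    by auto
  \<comment> \<open>\<open>z = w\<close> would make a null line invariant under the half-turn about \<open>c\<close>.\<close>
  then have "z + w = 0"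
    using b0 z1 unfolding z_def w_def by auto
  then have "b * (1 + \<zeta>) = 2"
  proof -
    have "\<i> * (2 - b * (1 + \<zeta>)) = 0"
      using \<open>z + w = 0\<close> unfolding z_def w_def by algebra
    then show ?thesis
      by simp
  qed
  then have "(1 - cnj \<zeta>) * (1 + \<zeta>) = D"
  proof -
    have "2 * (1 - cnj \<zeta>) = b * D"
      using D by (simp add: b_def)
    then have "2 * ((1 - cnj \<zeta>) * (1 + \<zeta>)) = 2 * D"
      using \<open>b * (1 + \<zeta>) = 2\<close> by algebra
    then show ?thesis
      by simp
  qed
  \<comment> \<open>Expanding the product leaves only the equality of \<zeta> with its conjugate:
    the center lies on the real diameter.\<close>
  then have "cnj \<zeta> = \<zeta>"
    unfolding D_def by (simp add: algebra_simps)
  then obtain r where r: "\<zeta> = of_real r"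
    by (metis Reals_cnj_iff Reals_cases)
  obtain s where "tanh s = r"
    using tanh_surj_real[of r] \<zeta>(2) r by auto
  then show thesis
    using that \<zeta>(1) r geodesic_point_tanh by blast
qed

text \<open>The first two centers can always be moved to the geodesic. The relation then forces the
  third onto it, unless the first two coincide, and a fixed-point argument determines the
  fourth.\<close>

lemma closing_standard:
  assumes "closing (c0, c1, c2, c3)"
  obtains g x y where "g \<in> unitary_group" "(g ` c0, g ` c1, g ` c2, g ` c3) = standard_quad x y"
proof -
  have c01: "c0 \<in> BV" "c1 \<in> BV"
    using assms by (simp_all add: closing_def)
  have "\<exists>g x. g \<in> unitary_group \<and> g ` c0 = geodesic_point 0 \<and> g ` c1 = geodesic_point x"
  proof -
    obtain g1 t where g1: "g1 \<in> unitary_group" "g1 ` c0 = geodesic_point t"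
      by (rule rotate_to_geodesic[OF c01(1)])
    obtain g2 where g2: "g2 \<in> unitary_group" "\<And>s. g2 ` geodesic_point s = geodesic_point (s + (- t))"
      using translation_along_geodesic[of "- t"] by metis
    have "g2 ` g1 ` c1 \<in> BV"
      using c01 g1 g2 unitary_BV by simp
    then obtain g3 x where g3: "g3 \<in> unitary_group" "g3 ` g2 ` g1 ` c1 = geodesic_point x"
        "g3 ` geodesic_point 0 = geodesic_point 0"
      using rotate_to_geodesic by metis
    have "(g3 \<circ> g2 \<circ> g1) \<in> unitary_group"
      using g1(1) g2(1) g3(1) by (simp add: unitary_comp)
    moreover have "(g3 \<circ> g2 \<circ> g1) ` c0 = geodesic_point 0" "(g3 \<circ> g2 \<circ> g1) ` c1 = geodesic_point x"
      unfolding image_comp[symmetric] g1(2) g2(2) g3(2) using g3(3) by simp_all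
    ultimately show ?thesis
      by (intro exI conjI)
  qed
  then obtain g1 x where g1: "g1 \<in> unitary_group" "g1 ` c0 = geodesic_point 0" "g1 ` c1 = geodesic_point x"
    by blast
  have closing1: "closing (geodesic_point 0, geodesic_point x, g1 ` c2, g1 ` c3)"
    using closing_image[OF g1(1) assms] g1 by simp
  then have c2: "g1 ` c2 \<in> BV"
    by (simp add: closing_def)
  have "\<exists>g s. g \<in> unitary_group \<and> g ` geodesic_point 0 = geodesic_point 0 \<and>
     g ` geodesic_point x = geodesic_point x \<and> g ` g1 ` c2 = geodesic_point s"
  proof (cases "x = 0")
    \<comment> \<open>Here c_0 = c_1 and no axis is distinguished; a rotation about this point moves
      c_2 to the geodesic and keeps both centers.\<close>
    case True
    then show ?thesis
      using rotate_to_geodesic[of "g1 ` c2"] c2 by metis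
  next
    case False
    define d2 d3 where "d2 = g1 ` c2" and "d3 = g1 ` c3"
    have d: "d2 \<in> BV" "d3 \<in> BV" and eq: "\<And>p. p \<in> PV \<Longrightarrow>
      half_turn d3 ` half_turn d2 ` half_turn (geodesic_point x) ` half_turn (geodesic_point 0) ` p = p"
      using closing1 unfolding closing_def d2_def d3_def by auto
    have g0: "half_turn (geodesic_point 0) \<in> unitary_group" "half_turn (geodesic_point x) \<in> unitary_group"
      by (intro half_turn_unitary geodesic_point_BV)+
    define N where "N = span {vec 1 1}"
    have N: "N \<in> PV"
      unfolding N_def by (rule span_vec_PV) simp
    have PV: "half_turn c ` p \<in> PV" if "c \<in> BV" "p \<in> PV" for c p
      using that half_turn_unitary unitary_PV by blast
    have "half_turn (geodesic_point x) (half_turn (geodesic_point 0) (vec 1 1)) =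
        scale (- of_real (cosh (2 * x) + sinh (2 * x))) (vec 1 1)"
      unfolding half_turn_half_turn_geodesic_vec scale_vec vec_eq_vec_iff by simp
    moreover have "cosh (2 * x) + sinh (2 * x) \<noteq> 0"
      by (simp add: cosh_plus_sinh)
    then have "- complex_of_real (cosh (2 * x) + sinh (2 * x)) \<noteq> 0"
      unfolding neg_equal_0_iff_equal of_real_eq_0_iff .
    ultimately have "half_turn (geodesic_point x) ` half_turn (geodesic_point 0) ` N = N"
      unfolding N_def unitary_span[OF g0(1)] unitary_span[OF g0(2)]
      using span_image_scale[of "{vec 1 1}" "\<lambda>_. - of_real (cosh (2 * x) + sinh (2 * x))"] by auto
    then have 32: "half_turn d3 ` half_turn d2 ` N = N"
      using eq[OF N] by simp
    \<comment> \<open>Cancelling the involutions R_3 and R_2 in the relation gives R_1 R_0 = R_2 R_3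
      on lines. As R_3 R_2 fixes N, the product R_2 R_3 fixes R_2 N, and so does the translation R_1
      R_0.\<close>
    have "half_turn (geodesic_point x) ` half_turn (geodesic_point 0) ` q = half_turn d2 ` half_turn d3 ` q"
      if "q \<in> PV" for q
      using eq[OF that] d PV half_turn_image_image that geodesic_point_BV by metis
    from this[OF PV[OF d(1) N]] have "half_turn (geodesic_point x) ` half_turn (geodesic_point 0) ` half_turn d2 ` N
        = half_turn d2 ` N"
      using 32 by simp
    then obtain s where "d2 = geodesic_point s"
      using null_lines_swapped[OF d(1) _ False] unfolding N_def by blast
    then show ?thesis
      using unitary_id unfolding d2_def by (metis image_id id_apply)
  qed
  then obtain g2 s where g2: "g2 \<in> unitary_group" "g2 ` geodesic_point 0 = geodesic_point 0"
     "g2 ` geodesic_point x = geodesic_point x" "g2 ` g1 ` c2 = geodesic_point s"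
    by blast
  have closing2: "closing (geodesic_point 0, geodesic_point x, geodesic_point s, g2 ` g1 ` c3)"
    using closing_image[OF g2(1) closing1] g2 by simp
  then have d3: "g2 ` g1 ` c3 \<in> BV"
    by (simp add: closing_def)
  \<comment> \<open>The half-turns at 0, x, s send s - x to x - s, then to x + s, then back to s -
    x. The last half-turn must therefore fix this point, which thus is its center.\<close>
  have "half_turn (g2 ` g1 ` c3) ` half_turn (geodesic_point s) ` half_turn (geodesic_point x) `
      half_turn (geodesic_point 0) ` geodesic_point (s - x) = geodesic_point (s - x)"
    using closing2 geodesic_point_PV[of "s - x"] by (simp only: closing_def prod.case)
  then have "half_turn (g2 ` g1 ` c3) ` geodesic_point (s - x) = geodesic_point (s - x)"
    by (simp add: half_turn_geodesic_geodesic algebra_simps)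
  then have "g2 ` g1 ` c3 = geodesic_point (s - x)"
    by (rule half_turn_fixed_unique[OF d3 geodesic_point_BV, symmetric])
  then have "((g2 \<circ> g1) ` c0, (g2 \<circ> g1) ` c1, (g2 \<circ> g1) ` c2, (g2 \<circ> g1) ` c3) = standard_quad x (s - x)"
    unfolding image_comp[symmetric] using g1 g2 by (simp add: standard_quad_def)
  then show thesis
    using that unitary_comp[OF g2(1) g1(1)] by blast
qed

subsection \<open>Hyperbolic distance\<close>

text \<open>The fraction is the squared hyperbolic cosine of the distance, so the square root is its
  hyperbolic sine. Unlike \<open>arcosh\<close>, \<open>arsinh\<close> is continuous on the whole
  real line, so continuity requires no lower bound on the fraction.\<close>

definition hdist :: "'v set \<Rightarrow> 'v set \<Rightarrow> real"
  where "hdist p q =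
    (let u = (SOME v. v \<in> p \<and> v \<noteq> 0); v = (SOME v. v \<in> q \<and> v \<noteq> 0)
     in arsinh (sqrt ((norm (form u v))\<^sup>2 / (Re (form u u) * Re (form v v)) - 1)))"

lemma some_span:
  assumes "u \<noteq> 0"
  obtains a where "a \<noteq> 0" "(SOME v. v \<in> span {u} \<and> v \<noteq> 0) = scale a u"
proof -
  have "u \<in> span {u} \<and> u \<noteq> 0"
    using assms span_base by auto
  then have "(SOME v. v \<in> span {u} \<and> v \<noteq> 0) \<in> span {u} \<and> (SOME v. v \<in> span {u} \<and> v \<noteq> 0) \<noteq> 0"
    by (rule someI)
  then show thesis
    using that by (auto simp: span_singleton)
qed

lemma Re_form_scale: "Re (form (scale a u) (scale a u)) = (norm a)\<^sup>2 * Re (form u u)"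
proof -
  have "form (scale a u) (scale a u) = (a * cnj a) * form u u"
    by (simp add: form_scale form_scale_right)
  also have "a * cnj a = of_real ((norm a)\<^sup>2)"
    by (rule complex_norm_square[symmetric])
  finally show ?thesis
    by simp
qed

lemma hdist_span:
  assumes "u \<noteq> 0" "v \<noteq> 0"
  shows "hdist (span {u}) (span {v})
    = arsinh (sqrt ((norm (form u v))\<^sup>2 / (Re (form u u) * Re (form v v)) - 1))"
proof -
  obtain a where a: "a \<noteq> 0" "(SOME v. v \<in> span {u} \<and> v \<noteq> 0) = scale a u"
    using some_span[OF assms(1)] .
  obtain b where b: "b \<noteq> 0" "(SOME w. w \<in> span {v} \<and> w \<noteq> 0) = scale b v"
    using some_span[OF assms(2)] .
  have "(norm (form (scale a u) (scale b v)))\<^sup>2 = (norm a)\<^sup>2 * (norm b)\<^sup>2 * (norm (form u v))\<^sup>2"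
    by (simp add: form_scale form_scale_right norm_mult power_mult_distrib)
  then have "(norm (form (scale a u) (scale b v)))\<^sup>2 / (Re (form (scale a u) (scale a u)) * Re (form (scale b v) (scale b v)))
      = (norm (form u v))\<^sup>2 / (Re (form u u) * Re (form v v))"
    using a(1) b(1) by (simp add: Re_form_scale)
  then show ?thesis
    unfolding hdist_def Let_def a(2) b(2) by simp
qed

lemma hdist_unitary:
  assumes g: "g \<in> unitary_group" and "p \<in> PV" "q \<in> PV"
  shows "hdist (g ` p) (g ` q) = hdist p q"
proof -
  obtain u where u: "p = span {u}" "u \<noteq> 0"
    using assms(2) by (auto simp: PV_def)
  obtain v where v: "q = span {v}" "v \<noteq> 0"
    using assms(3) by (auto simp: PV_def)
  show ?thesis
    unfolding u(1) v(1) unitary_span[OF g]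
    using u(2) v(2) unitary_nonzero[OF g] by (simp add: hdist_span unitary_groupD(4)[OF g])
qed

lemma hdist_geodesic: "hdist (geodesic_point s) (geodesic_point t) = \<bar>s - t\<bar>"
proof -
  have ne: "vec (of_real (cosh t)) (of_real (sinh t)) \<noteq> 0" for t
    unfolding vec_eq_0_iff using cosh_real_pos[of t] by (metis of_real_eq_0_iff less_irrefl)
  have "hdist (geodesic_point s) (geodesic_point t) = arsinh (sqrt ((cosh (s - t))\<^sup>2 - 1))"
    unfolding geodesic_point_def hdist_span[OF ne ne] form_cosh_sinh by simp
  also have "(cosh (s - t))\<^sup>2 - 1 = (sinh (s - t))\<^sup>2"
    by (simp add: cosh_square_eq)
  also have "sqrt ((sinh (s - t))\<^sup>2) = sinh \<bar>s - t\<bar>"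
    by simp
  finally show ?thesis
    unfolding arsinh_sinh_real .
qed

subsection \<open>Continuity\<close>

lemma continuous_map_V_top_form: "continuous_map V_top euclidean (\<lambda>v. form v x)"
  unfolding continuous_map_def
proof (intro conjI allI impI)
  fix U :: "complex set"
  assume "openin euclidean U"
  then have "open U"
    by simp
  show "openin V_top {v \<in> topspace V_top. form v x \<in> U}"
    unfolding openin_V_top
  proof (intro allI)
    fix u v
    have "continuous_on UNIV (\<lambda>(z, w). z * form u x + w * form v x)"
      by (auto simp: case_prod_unfold intro!: continuous_intros)
    then have "open ((\<lambda>(z, w). z * form u x + w * form v x) -` U)"
      by (rule open_vimage[OF \<open>open U\<close>])
    also have "(\<lambda>(z, w). z * form u x + w * form v x) -` U =
        {(z, w). scale z u + scale w v \<in> {v \<in> topspace V_top. form v x \<in> U}}"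
      by (auto simp: form_add form_scale)
    finally show "open {(z, w). scale z u + scale w v \<in> {v \<in> topspace V_top. form v x \<in> U}}" .
  qed
qed auto

text \<open>The affine chart w / z of the projective line, which identifies \<open>BV\<close> with
  the open unit disc.\<close>

definition slope :: "'v set \<Rightarrow> complex"
  where "slope p = (THE \<zeta>. p = span {vec 1 \<zeta>})"

lemma slope_span:
  assumes "z \<noteq> 0"
  shows "slope (span {vec z w}) = w / z"
  unfolding slope_def
proof (rule the_equality)
  show "span {vec z w} = span {vec 1 (w / z)}"
    using assms by (subst span_vec_eq_iff) auto
  show "\<zeta> = w / z" if "span {vec z w} = span {vec 1 \<zeta>}" for \<zeta>
    using that assms by (subst (asm) span_vec_eq_iff) (auto simp: field_simps)
qed

lemma span_in_BV_iff:
  assumes "v \<noteq> 0"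
  shows "span {v} \<in> BV \<longleftrightarrow> Re (form v v) > 0"
proof
  assume "span {v} \<in> BV"
  then obtain u where u: "span {v} = span {u}" "Re (form u u) > 0"
    by (auto simp: BV_def)
  then obtain a where "v = scale a u"
    using span_base[of v "{v}"] by (auto simp: span_singleton)
  then show "Re (form v v) > 0"
    using u(2) assms by (auto simp: Re_form_scale)
qed (rule span_BV)

text \<open>\<open>BV\<close> is open in the projective line, so the map from positive vectors to
  their lines is still a quotient map. It remains to see continuity on vectors, where the slope is -
  form v f / form v e; the minus sign comes from \<open>form_ff\<close>.\<close>

lemma continuous_map_slope: "continuous_map BV_top euclidean slope"
proof -
  let ?X = "subtopology V_top (- {0})"
  let ?P = "{v. Re (form v v) > 0}"
  have P: "{v \<in> topspace ?X. span {v} \<in> BV} = ?P"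
    by (auto simp: span_in_BV_iff intro: span_BV)
  have Re_form: "Re (form v v) = (norm (form v e))\<^sup>2 - (norm (form v f))\<^sup>2" for v
  proof -
    obtain z w where "v = vec z w"
      using vec_cases .
    then show ?thesis
      by (simp only: Re_form_vec coordinates norm_minus_cancel)
  qed
  have "continuous_map V_top euclidean (\<lambda>v. (form v e, form v f))"
    by (intro continuous_map_pair_euclidean continuous_map_V_top_form)
  then have form2: "continuous_map (subtopology V_top A) euclidean (\<lambda>v. (form v e, form v f))" for A
    by (rule continuous_map_from_subtopology)
  have "continuous_on UNIV (\<lambda>(z :: complex, w :: complex). (norm z)\<^sup>2 - (norm w)\<^sup>2)"
    by (auto simp: case_prod_unfold intro!: continuous_intros)
  from continuous_map_compose_continuous_on[OF form2[of "- {0}"] this]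
  have "continuous_map ?X euclideanreal (\<lambda>v. Re (form v v))"
    by (simp add: Re_form)
  then have "openin ?X {v \<in> topspace ?X. Re (form v v) \<in> {0<..}}"
    by (rule openin_continuous_map_preimage) simp
  also have "{v \<in> topspace ?X. Re (form v v) \<in> {0<..}} = {v \<in> topspace ?X. span {v} \<in> BV}"
    unfolding P by auto
  finally have "openin PV_top BV"
    unfolding PV_top_def openin_quotient_topology using BV_subset_PV by (auto simp: PV_def)
  then have quot: "quotient_map (subtopology ?X ?P) BV_top (\<lambda>v. span {v})"
    unfolding BV_top_def PV_top_def using P
    by (intro quotient_map_restriction quotient_map_quotient_topology) auto
  have "continuous_map (subtopology V_top (- {0} \<inter> ?P)) euclidean (\<lambda>v. (\<lambda>(z, w). - w / z) (form v e, form v f))"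
  proof (rule continuous_map_compose_continuous_on[OF form2])
    show "continuous_on {(z, w). z \<noteq> 0} (\<lambda>(z :: complex, w). - w / z)"
      by (auto simp: case_prod_unfold intro!: continuous_intros)
    show "(form v e, form v f) \<in> {(z, w). z \<noteq> 0}" if "v \<in> topspace (subtopology V_top (- {0} \<inter> ?P))" for v
      using that Re_form[of v] by auto
  qed
  moreover have "slope (span {v}) = - form v f / form v e" if "Re (form v v) > 0" for v
  proof -
    obtain z w where v: "v = vec z w"
      using vec_cases .
    have "(norm w)\<^sup>2 < (norm z)\<^sup>2"
      using that unfolding v Re_form_vec by simp
    then have "z \<noteq> 0"
      by auto
    then show ?thesis
      unfolding v coordinates slope_span[OF \<open>z \<noteq> 0\<close>] by simp
  qed
  ultimately have "continuous_map (subtopology ?X ?P) euclidean (slope \<circ> (\<lambda>v. span {v}))"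
    unfolding subtopology_subtopology by (elim continuous_map_eq) (auto simp: case_prod_unfold)
  then show ?thesis
    using continuous_compose_quotient_map[OF quot] by blast
qed

lemma topspace_BV_top: "topspace BV_top = BV"
  unfolding BV_top_def PV_top_def using BV_subset_PV by (auto simp: PV_def)

lemma norm_slope:
  assumes "p \<in> BV"
  shows "norm (slope p) < 1" "p = span {vec 1 (slope p)}"
proof -
  obtain \<zeta> where \<zeta>: "p = span {vec 1 \<zeta>}" "norm \<zeta> < 1"
    using BV_cases assms by blast
  have "slope p = \<zeta>"
    unfolding \<zeta>(1) using slope_span[of 1 \<zeta>] by simp
  then show "norm (slope p) < 1" "p = span {vec 1 (slope p)}"
    using \<zeta> by auto
qed

lemma continuous_map_hdist:
  assumes "continuous_map X BV_top p" "continuous_map X BV_top q"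
  shows "continuous_map X euclideanreal (\<lambda>x. hdist (p x) (q x))"
proof -
  define h where "h = (\<lambda>(\<zeta>, \<eta>). arsinh (sqrt ((norm (1 - \<zeta> * cnj \<eta>))\<^sup>2 /
     ((1 - (norm \<zeta>)\<^sup>2) * (1 - (norm \<eta>)\<^sup>2)) - 1)))"
  have BV: "p x \<in> BV" "q x \<in> BV" if "x \<in> topspace X" for x
    using that assms topspace_BV_top unfolding continuous_map_def by auto
  have lt1: "(norm z)\<^sup>2 < 1" if "norm z < 1" for z :: complex
    using that by (simp add: power_less_one_iff)
  have "continuous_map X euclidean (slope \<circ> p)" "continuous_map X euclidean (slope \<circ> q)"
    using assms continuous_map_slope continuous_map_compose by blast+
  then have "continuous_map X euclidean (\<lambda>x. (slope (p x), slope (q x)))"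
    by (intro continuous_map_pair_euclidean) (simp_all add: o_def)
  moreover have "continuous_on (ball 0 1 \<times> ball 0 1) h"
    unfolding h_def case_prod_unfold
    by (intro continuous_on_compose2[OF continuous_on_arsinh[of UNIV]] continuous_intros)
      (auto dest!: lt1)
  ultimately have "continuous_map X euclidean (\<lambda>x. h (slope (p x), slope (q x)))"
    by (rule continuous_map_compose_continuous_on) (simp add: BV norm_slope(1))
  moreover have "h (slope (p x), slope (q x)) = hdist (p x) (q x)" if "x \<in> topspace X" for x
  proof -
    have ne: "vec 1 z \<noteq> 0" for z
      unfolding vec_eq_0_iff by simp
    have "hdist (span {vec 1 \<zeta>}) (span {vec 1 \<eta>}) = h (\<zeta>, \<eta>)" for \<zeta> \<eta>
      unfolding hdist_span[OF ne ne] Re_form_vec unfolding form_vec by (simp add: h_def)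
    then show ?thesis
      using norm_slope(2)[OF BV(1)[OF that]] norm_slope(2)[OF BV(2)[OF that]] by metis
  qed
  ultimately show ?thesis
    by (rule continuous_map_eq)
qed

lemma continuous_map_geodesic_point: "continuous_map euclideanreal BV_top geodesic_point"
proof -
  have "continuous_map euclideanreal V_top (\<lambda>t. vec (of_real (cosh t)) (of_real (sinh t)))"
    unfolding continuous_map_def
  proof (intro conjI allI impI)
    fix U
    assume "openin V_top U"
    then have "open {(z, w). vec z w \<in> U}"
      by (simp add: openin_V_top)
    moreover have "continuous_on UNIV (\<lambda>t. (complex_of_real (cosh t), complex_of_real (sinh t)))"
      by (intro continuous_intros)
    ultimately have "open ((\<lambda>t. (complex_of_real (cosh t), complex_of_real (sinh t))) -` {(z, w). vec z w \<in> U})"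
      by (rule open_vimage)
    then show "openin euclideanreal {t \<in> topspace euclideanreal. vec (of_real (cosh t)) (of_real (sinh t)) \<in> U}"
      by (simp add: vimage_def)
  qed simp
  moreover have "vec (of_real (cosh t)) (of_real (sinh t)) \<noteq> 0" for t
    unfolding vec_eq_0_iff using cosh_real_pos[of t] by (metis of_real_eq_0_iff less_irrefl)
  ultimately have "continuous_map euclideanreal (subtopology V_top (- {0})) (\<lambda>t. vec (of_real (cosh t)) (of_real (sinh t)))"
    by (simp add: continuous_map_in_subtopology)
  then have "continuous_map euclideanreal PV_top ((\<lambda>v. span {v}) \<circ> (\<lambda>t. vec (of_real (cosh t)) (of_real (sinh t))))"
    unfolding PV_top_def
    by (rule continuous_map_compose[OF _ quotient_imp_continuous_map[OF quotient_map_quotient_topology]])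
  then show ?thesis
    unfolding BV_top_def continuous_map_in_subtopology
    using geodesic_point_BV by (simp add: o_def geodesic_point_def[abs_def])
qed

subsection \<open>Classes of quadrangles\<close>

fun quad_image :: "('v \<Rightarrow> 'v) \<Rightarrow> 'v set quad \<Rightarrow> 'v set quad"
  where "quad_image g (c0, c1, c2, c3) = (g ` c0, g ` c1, g ` c2, g ` c3)"

lemma PU_class_quad_image: "PU_class c = (\<lambda>g. quad_image g c) ` unitary_group"
  by (cases c) (auto simp: PU_class_def)

lemma quad_image_comp: "quad_image (g \<circ> h) c = quad_image g (quad_image h c)"
  by (cases c) (simp add: image_image)

lemma quad_image_inv: "g \<in> unitary_group \<Longrightarrow> quad_image (inv_into UNIV g) (quad_image g c) = c"
  by (cases c) (simp add: unitary_image_inv)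

lemma PU_class_image:
  assumes g: "g \<in> unitary_group"
  shows "PU_class (quad_image g c) = PU_class c"
proof -
  have sub: "PU_class (quad_image h d) \<subseteq> PU_class d" if "h \<in> unitary_group" for h d
    unfolding PU_class_quad_image using that unitary_comp by (auto simp flip: quad_image_comp)
  show ?thesis
    using sub[OF g] sub[OF unitary_inv[OF g], of "quad_image g c"]
    unfolding quad_image_inv[OF g] by (rule subset_antisym)
qed

lemma PU_class_self: "c \<in> PU_class c"
  unfolding PU_class_quad_image using unitary_id by (cases c) (auto intro!: image_eqI[of _ _ id])

abbreviation hexagons_top :: "hex_type \<Rightarrow> 'v set quad topology"
  where "hexagons_top ty \<equiv>
    subtopology (prod_topology BV_top (prod_topology BV_top (prod_topology BV_top BV_top)))
      (hexagon_quads ty (pi / 2) (pi / 2) (pi / 2) (pi / 2))"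

abbreviation hexagon_classes_top :: "hex_type \<Rightarrow> 'v set quad set topology"
  where "hexagon_classes_top ty \<equiv> hexagon_space ty (pi / 2) (pi / 2) (pi / 2) (pi / 2)"

definition standard_class :: "real^2 \<Rightarrow> 'v set quad set"
  where "standard_class v = PU_class (standard_quad (v$1) (v$2))"

lemma closing_iff:
  "closing c \<longleftrightarrow> (\<exists>g\<in>unitary_group. \<exists>v :: real^2. c = quad_image g (standard_quad (v$1) (v$2)))"
proof (cases c)
  case (fields c0 c1 c2 c3)
  show ?thesis
  proof
    assume "closing c"
    then obtain g x y where g: "g \<in> unitary_group" "(g ` c0, g ` c1, g ` c2, g ` c3) = standard_quad x y"
      using closing_standard unfolding fields by blast
    then have "c = quad_image (inv_into UNIV g) (standard_quad x y)"
      using quad_image_inv[OF g(1), of c] by (simp add: fields)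
    then have "c = quad_image (inv_into UNIV g) (standard_quad ((vector [x, y] :: real^2)$1) ((vector [x, y] :: real^2)$2))"
      by simp
    then show "\<exists>g\<in>unitary_group. \<exists>v :: real^2. c = quad_image g (standard_quad (v$1) (v$2))"
      using unitary_inv[OF g(1)] by blast
  next
    assume "\<exists>g\<in>unitary_group. \<exists>v :: real^2. c = quad_image g (standard_quad (v$1) (v$2))"
    then obtain g and v :: "real^2" where "g \<in> unitary_group" "c = quad_image g (standard_quad (v$1) (v$2))"
      by blast
    then show "closing c"
      using closing_image[OF _ closing_geodesic[of 0 "v$1 + v$2" "v$1" "v$2"]] by (simp add: standard_quad_def)
  qed
qed

lemma topspace_hexagons_top: "topspace (hexagons_top ty) = {c. closing c}"
  unfolding hexagon_quads_half_pi by (auto simp: topspace_BV_top closing_def)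

lemma topspace_hexagon_classes_top: "topspace (hexagon_classes_top ty) = range standard_class"
proof -
  have "topspace (hexagon_classes_top ty) = PU_class ` {c. closing c}"
    unfolding hexagon_space_def topspace_quotient_topology topspace_hexagons_top ..
  also have "\<dots> = range standard_class"
  proof (intro equalityI subsetI)
    fix K assume "K \<in> PU_class ` {c. closing c}"
    then obtain c where c: "closing c" "K = PU_class c"
      by blast
    then obtain g and v :: "real^2" where "g \<in> unitary_group" "c = quad_image g (standard_quad (v$1) (v$2))"
      unfolding closing_iff by blast
    then show "K \<in> range standard_class"
      unfolding c(2) standard_class_def by (simp add: PU_class_image)
  next
    fix K assume "K \<in> range standard_class"
    then obtain v :: "real^2" where v: "K = PU_class (standard_quad (v$1) (v$2))"
      by (auto simp: standard_class_def)
    have "closing (standard_quad (v$1) (v$2))"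
      unfolding standard_quad_def by (rule closing_geodesic) simp
    then show "K \<in> PU_class ` {c. closing c}"
      unfolding v by blast
  qed
  finally show ?thesis .
qed

lemma standard_class_geodesic:
  assumes "t0 + t2 = t1 + t3"
  shows "PU_class (geodesic_point t0, geodesic_point t1, geodesic_point t2, geodesic_point t3)
    = standard_class (vector [t1 - t0, t2 - t1])"
proof -
  obtain g where g: "g \<in> unitary_group" "\<And>t. g ` geodesic_point t = geodesic_point (t + t0)"
    using translation_along_geodesic[of t0] by metis
  have "quad_image g (standard_quad (t1 - t0) (t2 - t1))
      = (geodesic_point t0, geodesic_point t1, geodesic_point t2, geodesic_point t3)"
    using assms by (simp add: standard_quad_def g(2)) (simp add: algebra_simps)
  then show ?thesis
    using PU_class_image[OF g(1), of "standard_quad (t1 - t0) (t2 - t1)"] by (simp add: standard_class_def)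
qed

text \<open>The half-turn about the first center reverses the geodesic. This is the origin of the
  quotient by +-1.\<close>

lemma standard_class_minus: "standard_class (- v) = standard_class v"
proof -
  note g = half_turn_unitary[OF geodesic_point_BV[of 0]]
  have "quad_image (half_turn (geodesic_point 0)) (standard_quad (v$1) (v$2)) = standard_quad ((- v)$1) ((- v)$2)"
    by (simp add: standard_quad_def half_turn_geodesic_geodesic)
  then show ?thesis
    using PU_class_image[OF g, of "standard_quad (v$1) (v$2)"] by (simp add: standard_class_def)
qed

lemma continuous_map_standard_class:
  "continuous_map euclidean (hexagon_classes_top ty) standard_class"
proof -
  have geo: "continuous_map euclidean BV_top (\<lambda>v. geodesic_point (h v))"
    if "continuous_on UNIV h" for h :: "real^2 \<Rightarrow> real"
    using continuous_map_compose[OF _ continuous_map_geodesic_point, of euclidean h] that by (simp add: o_def)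
  have "continuous_map euclidean (hexagons_top ty) (\<lambda>v :: real^2. standard_quad (v$1) (v$2))"
    unfolding continuous_map_in_subtopology hexagon_quads_half_pi standard_quad_def
    by (intro conjI continuous_map_pairedI geo continuous_intros) (simp add: closing_geodesic)
  then have "continuous_map euclidean (hexagon_classes_top ty) (PU_class \<circ> (\<lambda>v :: real^2. standard_quad (v$1) (v$2)))"
    unfolding hexagon_space_def
    by (rule continuous_map_compose[OF _ quotient_imp_continuous_map[OF quotient_map_quotient_topology]])
  then show ?thesis
    by (simp add: o_def standard_class_def[abs_def])
qed

fun plane_point :: "'v set quad \<Rightarrow> (real^2) set"
  where "plane_point (c0, c1, c2, c3) = pm_class
    (if max (hdist c0 c1) (hdist c1 c2) \<le> hdist c0 c2 then vector [hdist c0 c1, hdist c1 c2]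
     else vector [hdist c0 c1, - hdist c1 c2])"

text \<open>With \<open>x = t\<^sub>1 - t\<^sub>0\<close> and \<open>y = t\<^sub>2 - t\<^sub>1\<close>, the distances are \<open>\<bar>x\<bar>\<close>, \<open>\<bar>y\<bar>\<close>, \<open>\<bar>x + y\<bar>\<close>, and the last of
  them decides whether \<open>x\<close> and \<open>y\<close> have the same sign.\<close>

lemma plane_point_standard: "plane_point (standard_quad (v$1) (v$2)) = pm_class v"
proof -
  have dist: "hdist (geodesic_point 0) (geodesic_point x) = \<bar>x\<bar>"
    "hdist (geodesic_point x) (geodesic_point (x + y)) = \<bar>y\<bar>" for x y
    unfolding hdist_geodesic by linarith+
  show ?thesis
    unfolding standard_quad_def plane_point.simps dist pm_class_eq_iff
    by (simp add: vec_eq_iff forall_2) linarith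
qed

lemma closing_BV:
  assumes "closing (c0, c1, c2, c3)"
  shows "c0 \<in> BV" "c1 \<in> BV" "c2 \<in> BV" "c3 \<in> BV"
  using assms by (simp_all add: closing_def)

lemma plane_point_quad_image:
  assumes g: "g \<in> unitary_group" and c: "closing c"
  shows "plane_point (quad_image g c) = plane_point c"
proof (cases c)
  case (fields c0 c1 c2 c3)
  then show ?thesis
    using hdist_unitary[OF g] closing_BV[OF c[unfolded fields]] BV_subset_PV by (simp add: subset_iff)
qed

text \<open>The two branches must agree on the border of the case distinction. There x = 0 or y = 0:
  for y = 0 both vectors are equal, and for x = 0 they are opposite, hence equal in the
  quotient.\<close>

lemma continuous_map_plane_point: "continuous_map (hexagons_top ty) plane_mod_pm plane_point"
proof -
  define X where "X = hexagons_top ty"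
  define c0 c1 c2 where "c0 = (fst :: 'v set quad \<Rightarrow> 'v set)" and "c1 = (\<lambda>c :: 'v set quad. fst (snd c))"
    and "c2 = (\<lambda>c :: 'v set quad. fst (snd (snd c)))"
  have "continuous_map X BV_top c0" "continuous_map X BV_top c1" "continuous_map X BV_top c2"
    unfolding X_def c0_def c1_def c2_def
    by (intro continuous_map_from_subtopology continuous_map_fst continuous_map_snd
      continuous_map_fst_of[OF continuous_map_snd, unfolded o_def]
      continuous_map_fst_of[OF continuous_map_snd_of[OF continuous_map_snd], unfolded o_def])+
  note hdist = continuous_map_hdist[OF this(1,2)] continuous_map_hdist[OF this(2,3)] continuous_map_hdist[OF this(1,3)]
  have vec: "continuous_map X plane_mod_pm (\<lambda>c. pm_class (vector [a c, b c]))"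
    if "continuous_map X euclideanreal a" "continuous_map X euclideanreal b" for a b
  proof -
    have "continuous_on UNIV (\<lambda>(x :: real, y :: real). vector [x, y] :: real^2)"
    proof -
      have "(\<lambda>(x :: real, y :: real). vector [x, y] :: real^2) = (\<lambda>p. fst p *\<^sub>R vector [1, 0] + snd p *\<^sub>R vector [0, 1])"
        by (auto simp: vec_eq_iff forall_2)
      then show ?thesis
        by (simp add: continuous_intros)
    qed
    from continuous_map_compose_continuous_on[OF continuous_map_pair_euclidean[OF that] this]
    have "continuous_map X euclidean (\<lambda>c. vector [a c, b c] :: real^2)"
      by simp
    from continuous_map_compose[OF this quotient_imp_continuous_map[OF quotient_map_pm_class]]
    show ?thesis
      by (simp add: o_def)
  qed
  have "continuous_map X plane_mod_pm (\<lambda>c. if max (hdist (c0 c) (c1 c)) (hdist (c1 c) (c2 c)) \<le> hdist (c0 c) (c2 c)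
      then pm_class (vector [hdist (c0 c) (c1 c), hdist (c1 c) (c2 c)])
      else pm_class (vector [hdist (c0 c) (c1 c), - hdist (c1 c) (c2 c)]))"
  proof (rule continuous_map_cases_le)
    fix c
    assume "c \<in> topspace X"
    then obtain g and v :: "real^2" where c: "g \<in> unitary_group" "c = quad_image g (standard_quad (v$1) (v$2))"
      unfolding X_def topspace_hexagons_top closing_iff by blast
    assume "max (hdist (c0 c) (c1 c)) (hdist (c1 c) (c2 c)) = hdist (c0 c) (c2 c)"
    then have "max \<bar>v$1\<bar> \<bar>v$2\<bar> = \<bar>v$1 + v$2\<bar>"
      by (simp add: c c0_def c1_def c2_def standard_quad_def hdist_unitary geodesic_point_PV hdist_geodesic)
    then have "v$1 = 0 \<or> v$2 = 0"
      by linarith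
    then show "pm_class (vector [hdist (c0 c) (c1 c), hdist (c1 c) (c2 c)]) =
        pm_class (vector [hdist (c0 c) (c1 c), - hdist (c1 c) (c2 c)])"
      by (auto simp: c c0_def c1_def c2_def standard_quad_def hdist_unitary geodesic_point_PV hdist_geodesic
        pm_class_eq_iff vec_eq_iff forall_2)
  qed (intro continuous_map_from_subtopology vec hdist continuous_map_real_max continuous_map_minus)+
  moreover have "plane_point = (\<lambda>c. if max (hdist (c0 c) (c1 c)) (hdist (c1 c) (c2 c)) \<le> hdist (c0 c) (c2 c)
      then pm_class (vector [hdist (c0 c) (c1 c), hdist (c1 c) (c2 c)])
      else pm_class (vector [hdist (c0 c) (c1 c), - hdist (c1 c) (c2 c)]))"
    by (auto simp: fun_eq_iff c0_def c1_def c2_def)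
  ultimately show ?thesis
    unfolding X_def by simp
qed

definition class_to_plane :: "'v set quad set \<Rightarrow> (real^2) set"
  where "class_to_plane K = plane_point (SOME c. c \<in> K)"

lemma class_to_plane_PU_class:
  assumes "closing c"
  shows "class_to_plane (PU_class c) = plane_point c"
proof -
  have "(SOME d. d \<in> PU_class c) \<in> PU_class c"
    using PU_class_self by (rule someI)
  then show ?thesis
    unfolding class_to_plane_def PU_class_quad_image
    by (elim imageE) (simp only: plane_point_quad_image[OF _ assms])
qed

lemma class_to_plane_standard: "class_to_plane (standard_class v) = pm_class v"
proof -
  have "closing (standard_quad (v$1) (v$2))"
    unfolding standard_quad_def by (rule closing_geodesic) simp
  then show ?thesis
    unfolding standard_class_def by (simp only: class_to_plane_PU_class plane_point_standard)
qed

text \<open>\<open>class_to_plane\<close> recovers v up to sign from distances, which do not depend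
  on the representative quadrangle.\<close>

lemma standard_class_eq_iff: "standard_class v = standard_class w \<longleftrightarrow> v = w \<or> v = - w"
  using class_to_plane_standard pm_class_eq_iff standard_class_minus by metis

definition plane_to_class :: "(real^2) set \<Rightarrow> 'v set quad set"
  where "plane_to_class p = standard_class (SOME v. pm_class v = p)"

lemma plane_to_class_pm_class: "plane_to_class (pm_class v) = standard_class v"
proof -
  have "pm_class (SOME w. pm_class w = pm_class v) = pm_class v"
    by (rule someI[of _ v]) simp
  then show ?thesis
    unfolding plane_to_class_def pm_class_eq_iff standard_class_eq_iff .
qed

lemma homeomorphic_maps_class_to_plane:
  "homeomorphic_maps (hexagon_classes_top ty) plane_mod_pm class_to_plane plane_to_class"
  unfolding homeomorphic_maps_def
proof (intro conjI ballI)
  have "continuous_map (hexagons_top ty) plane_mod_pm (class_to_plane \<circ> PU_class)"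
    using continuous_map_plane_point
    by (rule continuous_map_eq) (simp only: topspace_hexagons_top o_apply mem_Collect_eq class_to_plane_PU_class)
  then show "continuous_map (hexagon_classes_top ty) plane_mod_pm class_to_plane"
    unfolding hexagon_space_def by (rule continuous_compose_quotient_map[OF quotient_map_quotient_topology])
  have "plane_to_class \<circ> pm_class = standard_class"
    by (auto simp: plane_to_class_pm_class)
  then show "continuous_map plane_mod_pm (hexagon_classes_top ty) plane_to_class"
    using continuous_compose_quotient_map[OF quotient_map_pm_class] continuous_map_standard_class by metis
  show "plane_to_class (class_to_plane K) = K" if "K \<in> topspace (hexagon_classes_top ty)" for K
    using that unfolding topspace_hexagon_classes_top by (auto simp: class_to_plane_standard plane_to_class_pm_class)
  show "class_to_plane (plane_to_class p) = p" if "p \<in> topspace plane_mod_pm" for p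
    using that unfolding topspace_plane_mod_pm by (auto simp: class_to_plane_standard plane_to_class_pm_class)
qed

subsection \<open>The modifications\<close>

text \<open>A modification of a class is defined as the set of modified members. Equivariance makes
  this set a single class again, so one representative suffices.\<close>

lemma image_PU_class:
  assumes "\<And>g. g \<in> unitary_group \<Longrightarrow> m (quad_image g c) = quad_image g (m c)"
  shows "m ` PU_class c = PU_class (m c)"
  unfolding PU_class_quad_image image_image using assms by (rule image_cong[OF refl])

lemma modify_quad_quad_image:
  assumes g: "g \<in> unitary_group" and c: "closing c"
    and F: "F = factors1 \<or> F = factors2 \<or> F = factors3"
  shows "modify_quad (F ty) (pi / 2) (pi / 2) (pi / 2) (pi / 2) (quad_image g c)
    = quad_image g (modify_quad (F ty) (pi / 2) (pi / 2) (pi / 2) (pi / 2) c)"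
proof (cases c)
  case (fields c0 c1 c2 c3)
  note BV = closing_BV[OF c[unfolded fields]]
  show ?thesis
    using F by (elim disjE) (simp_all only: fields quad_image.simps modify_quad_half_pi BV unitary_BV[OF g]
        half_turns_equivariant[OF g])
qed

abbreviation S_half_pi :: "(hex_type \<times> 'v set quad set) topology"
  where "S_half_pi \<equiv> S (pi / 2) (pi / 2) (pi / 2) (pi / 2)"

abbreviation modification_half_pi ::
    "(hex_type \<Rightarrow> ('v \<Rightarrow> 'v) quad \<Rightarrow> ('v \<Rightarrow> 'v) quad) \<Rightarrow>
      hex_type \<times> 'v set quad set \<Rightarrow> hex_type \<times> 'v set quad set"
  where "modification_half_pi F \<equiv> modification F (pi / 2) (pi / 2) (pi / 2) (pi / 2)"

lemma topspace_S: "topspace S_half_pi = UNIV \<times> range standard_class"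
  by (auto simp: S_def topspace_hexagon_classes_top)

lemma S_cases:
  assumes "x \<in> topspace S_half_pi"
  obtains ty v where "x = (ty, standard_class v)"
  using assms unfolding topspace_S by blast

text \<open>The flag \<open>b\<close> records whether types are exchanged. The matrix is determined
  by \<open>m\<close> at best up to sign, since A and -A act alike on classes.\<close>

definition acts_as :: "(hex_type \<times> 'v set quad set \<Rightarrow> hex_type \<times> 'v set quad set) \<Rightarrow> bool \<Rightarrow> int^2^2 \<Rightarrow> bool"
  where "acts_as m b A \<longleftrightarrow> (\<forall>ty v. m (ty, standard_class v) =
    (if b then other_type ty else ty, standard_class (int_act A v)))"

lemma modification_standard:
  assumes F: "F = factors1 \<or> F = factors2 \<or> F = factors3"
    and t: "modify_quad (F ty) (pi / 2) (pi / 2) (pi / 2) (pi / 2) (standard_quad (v$1) (v$2)) =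
      (geodesic_point t0, geodesic_point t1, geodesic_point t2, geodesic_point t3)"
    and "t0 + t2 = t1 + t3" "vector [t1 - t0, t2 - t1] = w \<or> vector [t1 - t0, t2 - t1] = - w"
  shows "modification_half_pi F (ty, standard_class v) = (other_type ty, standard_class w)"
proof -
  have closing: "closing (standard_quad (v$1) (v$2))"
    unfolding standard_quad_def by (rule closing_geodesic) simp
  have "modify_quad (F ty) (pi / 2) (pi / 2) (pi / 2) (pi / 2) ` standard_class v =
      PU_class (geodesic_point t0, geodesic_point t1, geodesic_point t2, geodesic_point t3)"
    unfolding standard_class_def t[symmetric]
    by (rule image_PU_class) (rule modify_quad_quad_image[OF _ closing F])
  also have "\<dots> = standard_class w"
    using assms(3,4) by (simp only: standard_class_geodesic standard_class_eq_iff)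
  finally show ?thesis
    by (simp add: modification_def topspace_S)
qed

text \<open>A half-turn at s sends position t to 2 s - t. Applied to the positions 0, x, x + y, y,
  the modifications give the differences (x - 2 y, -y), (x, -y) and (-x, y - 2 x); the last is the
  claimed vector only up to sign.\<close>

lemma modifications_act:
  "acts_as (modification_half_pi factors1) True (mat2 1 2 0 1 ** reflection)"
  "acts_as (modification_half_pi factors2) True reflection"
  "acts_as (modification_half_pi factors3) True (mat2 1 0 2 1 ** reflection)"
  unfolding acts_as_def if_True reflection_def mat2_mult
proof safe
  fix ty and v :: "real^2"
  define x y where "x = v$1" and "y = v$2"
  note quad = modify_quad_half_pi[OF geodesic_point_BV geodesic_point_BV geodesic_point_BV geodesic_point_BV]
    standard_quad_def half_turn_geodesic_geodesic
  show "modification_half_pi factors1 (ty, standard_class v) =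
      (other_type ty, standard_class (int_act (mat2 (1 * 1 + 2 * 0) (1 * 0 + 2 * - 1) (0 * 1 + 1 * 0) (0 * 0 + 1 * - 1)) v))"
    by (rule modification_standard[where ?t0.0 = "2 * y - 0" and ?t1.0 = x and ?t2.0 = "2 * x - (x + y)" and ?t3.0 = y])
      (simp_all only: quad x_def y_def, simp_all add: vec_eq_iff forall_2 int_act_mat2)
  show "modification_half_pi factors2 (ty, standard_class v) =
      (other_type ty, standard_class (int_act (mat2 1 0 0 (- 1)) v))"
    by (rule modification_standard[where ?t0.0 = "2 * y - 0" and ?t1.0 = "2 * (x + y) - x" and ?t2.0 = "x + y" and ?t3.0 = y])
      (simp_all only: quad x_def y_def, simp_all add: vec_eq_iff forall_2 int_act_mat2)
  show "modification_half_pi factors3 (ty, standard_class v) =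
      (other_type ty, standard_class (int_act (mat2 (1 * 1 + 0 * 0) (1 * 0 + 0 * - 1) (2 * 1 + 1 * 0) (2 * 0 + 1 * - 1)) v))"
    by (rule modification_standard[where ?t0.0 = "2 * x - 0" and ?t1.0 = x and ?t2.0 = "2 * y - (x + y)" and ?t3.0 = y])
      (simp_all only: quad x_def y_def, simp_all add: vec_eq_iff forall_2 int_act_mat2)
qed

lemma acts_as_compose:
  assumes "acts_as m b A" "acts_as m' b' A'"
  shows "acts_as (compose (topspace S_half_pi) m m') (b \<noteq> b') (A ** A')"
proof -
  have "other_type (other_type ty) = ty" for ty
    by (cases ty) simp_all
  then show ?thesis
    using assms by (simp add: acts_as_def compose_def topspace_S int_act_mult)
qed

lemma acts_as_id: "acts_as (\<lambda>x\<in>topspace S_half_pi. x) False (mat 1)"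
  by (simp add: acts_as_def topspace_S int_act_1)

lemma acts_as_in_topspace: "acts_as m b A \<Longrightarrow> x \<in> topspace S_half_pi \<Longrightarrow> m x \<in> topspace S_half_pi"
  unfolding acts_as_def topspace_S by auto

lemma acts_as_unique:
  assumes "acts_as m b A" "acts_as m' b A" "x \<in> topspace S_half_pi"
  shows "m x = m' x"
proof -
  obtain ty v where "x = (ty, standard_class v)"
    by (rule S_cases[OF assms(3)])
  then show ?thesis
    using assms(1,2) unfolding acts_as_def by metis
qed

abbreviation modifications
  where "modifications \<equiv> {modification_half_pi factors1, modification_half_pi factors2, modification_half_pi factors3}"

lemma modification_acts_as:
  assumes "m \<in> modifications"
  obtains A where "acts_as m True (A ** reflection)" "A \<in> Gamma2"
    "A ** reflection ** (A ** reflection) = mat 1"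
proof -
  have "mat 1 ** reflection = reflection"
    by simp
  then have "acts_as (modification_half_pi factors2) True (mat 1 ** reflection)"
    using modifications_act(2) by simp
  moreover have "mat2 1 2 0 1 ** reflection ** (mat2 1 2 0 1 ** reflection) = mat 1"
    "mat2 1 0 2 1 ** reflection ** (mat2 1 0 2 1 ** reflection) = mat 1"
    "mat 1 ** reflection ** (mat 1 ** reflection) = mat 1"
    by (simp_all add: reflection_def mat2_mult mat2_1)
  ultimately show thesis
    using assms that modifications_act(1,3) Gamma2_generators Gamma2_one by blast
qed

text \<open>The matrix of each modification squares to 1 and two exchanges of type cancel. Being its
  own inverse makes it a bijection, hence an element of \<open>BijGroup\<close>.\<close>

lemma modification_involution:
  assumes "m \<in> modifications"
  shows "compose (topspace S_half_pi) m m = (\<lambda>x\<in>topspace S_half_pi. x)" "m \<in> Bij (topspace S_half_pi)"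
proof -
  obtain A where A: "acts_as m True (A ** reflection)" "A ** reflection ** (A ** reflection) = mat 1"
    using modification_acts_as[OF assms] by blast
  have "acts_as (compose (topspace S_half_pi) m m) False (mat 1)"
    using acts_as_compose[OF A(1) A(1)] A(2) by simp
  then have *: "compose (topspace S_half_pi) m m x = x" if "x \<in> topspace S_half_pi" for x
    using acts_as_unique[OF _ acts_as_id] that by fastforce
  then show "compose (topspace S_half_pi) m m = (\<lambda>x\<in>topspace S_half_pi. x)"
    by (auto simp: compose_def restrict_def fun_eq_iff)
  have "m \<in> extensional (topspace S_half_pi)"
    using assms by (auto simp: modification_def)
  moreover have "bij_betw m (topspace S_half_pi) (topspace S_half_pi)"
    by (rule bij_betw_byWitness[of _ m]) (use * acts_as_in_topspace[OF A(1)] in \<open>auto simp: compose_eq\<close>)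
  ultimately show "m \<in> Bij (topspace S_half_pi)"
    by (simp add: Bij_def)
qed

lemma inv_modification:
  assumes "m \<in> modifications"
  shows "inv\<^bsub>BijGroup (topspace S_half_pi)\<^esub> m = m"
proof -
  interpret group "BijGroup (topspace S_half_pi)"
    by (rule group_BijGroup)
  show ?thesis
    by (rule inv_equality) (use modification_involution[OF assms] in \<open>auto simp: BijGroup_def\<close>)
qed

abbreviation "M3_half_pi \<equiv> M3 (pi / 2) (pi / 2) (pi / 2) (pi / 2)"
abbreviation "M_half_pi \<equiv> M (pi / 2) (pi / 2) (pi / 2) (pi / 2)"

lemma compose_M3:
  assumes "m \<in> M3_half_pi" "m' \<in> M3_half_pi"
  shows "compose (topspace S_half_pi) m m' \<in> M3_half_pi"
proof -
  have "modifications \<subseteq> carrier (BijGroup (topspace S_half_pi))"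
    using modification_involution(2) by (simp add: BijGroup_def)
  then have "M3_half_pi \<subseteq> carrier (BijGroup (topspace S_half_pi))"
    unfolding M3_def by (rule group.generate_incl[OF group_BijGroup])
  then have "m \<in> Bij (topspace S_half_pi)" "m' \<in> Bij (topspace S_half_pi)"
    using assms by (auto simp: BijGroup_def)
  then show ?thesis
    using generate.eng[of m "BijGroup (topspace S_half_pi)" modifications m'] assms
    by (simp add: M3_def BijGroup_def)
qed

text \<open>The invariant ties the exchange of types to the presence of \<open>reflection\<close>.
  In a product, a reflection standing before A' passes to its right at the price of conjugating A',
  which stays in \<open>Gamma2\<close>.\<close>

lemma M3_acts_as:
  assumes "m \<in> M3_half_pi"
  shows "m \<in> Bij (topspace S_half_pi) \<and>
    (\<exists>A\<in>Gamma2. acts_as m False A \<or> acts_as m True (A ** reflection))"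
  using assms unfolding M3_def
proof (induction rule: generate.induct)
  case one
  have "(\<lambda>x\<in>topspace S_half_pi. x) \<in> Bij (topspace S_half_pi)"
    by (auto simp: Bij_def bij_betw_def inj_on_def)
  moreover have "\<one>\<^bsub>BijGroup (topspace S_half_pi)\<^esub> = (\<lambda>x\<in>topspace S_half_pi. x)"
    by (simp add: BijGroup_def)
  ultimately show ?case
    using acts_as_id Gamma2_one by metis
next
  case (incl h)
  then show ?case
    using modification_acts_as[OF incl] modification_involution[OF incl] by metis
next
  case (inv h)
  then show ?case
    unfolding inv_modification[OF inv]
    using modification_acts_as[OF inv] modification_involution[OF inv] by metis
next
  case (eng m m')
  obtain A where A: "A \<in> Gamma2" "acts_as m False A \<or> acts_as m True (A ** reflection)"
    using eng.IH(1) by blast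
  obtain A' where A': "A' \<in> Gamma2" "acts_as m' False A' \<or> acts_as m' True (A' ** reflection)"
    using eng.IH(2) by blast
  define A'' where "A'' = reflection ** A' ** reflection"
  have A'': "A'' \<in> Gamma2"
    unfolding A''_def by (rule Gamma2_conjugate_reflection[OF A'(1)])
  have 1: "A ** (A' ** reflection) = A ** A' ** reflection"
    by (simp add: matrix_mul_assoc)
  have 2: "A ** reflection ** A' = A ** A'' ** reflection"
    unfolding A''_def by (simp add: matrix_mul_assoc mult_reflection_reflection)
  have 3: "A ** reflection ** (A' ** reflection) = A ** A''"
    unfolding A''_def by (simp add: matrix_mul_assoc)
  let ?c = "compose (topspace S_half_pi) m m'"
  have "acts_as ?c False (A ** A') \<or> acts_as ?c True (A ** A' ** reflection) \<or>
      acts_as ?c True (A ** A'' ** reflection) \<or> acts_as ?c False (A ** A'')"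
    using A(2) A'(2) acts_as_compose[of m False A m' False A'] acts_as_compose[of m False A m' True "A' ** reflection"]
      acts_as_compose[of m True "A ** reflection" m' False A']
      acts_as_compose[of m True "A ** reflection" m' True "A' ** reflection"]
    unfolding 1 2 3 by auto
  then have "\<exists>B\<in>Gamma2. acts_as ?c False B \<or> acts_as ?c True (B ** reflection)"
    using Gamma2_mult[OF A(1) A'(1)] Gamma2_mult[OF A(1) A''] by blast
  then show ?case
    using eng.IH by (simp add: BijGroup_def compose_Bij)
qed

lemma M_acts_as:
  assumes "m \<in> M_half_pi"
  obtains A where "A \<in> Gamma2" "acts_as m False A"
proof -
  have m: "m \<in> M3_half_pi" "\<And>x. x \<in> topspace S_half_pi \<Longrightarrow> fst (m x) = fst x"
    using assms by (auto simp: M_def)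
  obtain A where A: "A \<in> Gamma2" "acts_as m False A \<or> acts_as m True (A ** reflection)"
    using M3_acts_as[OF m(1)] by blast
  \<comment> \<open>A map that exchanges types already fails to preserve the type of the class at
    the origin.\<close>
  have "\<not> acts_as m True B" for B
  proof
    assume "acts_as m True B"
    then have "m (First, standard_class 0) = (other_type First, standard_class (int_act B 0))"
      unfolding acts_as_def if_True by blast
    then show False
      using m(2)[of "(First, standard_class 0)"] by (simp add: topspace_S)
  qed
  then show thesis
    using that A by blast
qed

lemma Gamma2_acts:
  assumes "A \<in> Gamma2"
  obtains m where "m \<in> M_half_pi" "acts_as m False A"
proof -
  let ?n1 = "modification_half_pi factors1" and ?n2 = "modification_half_pi factors2"
    and ?n3 = "modification_half_pi factors3"
  have n: "?n1 \<in> M3_half_pi" "?n2 \<in> M3_half_pi" "?n3 \<in> M3_half_pi"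
    unfolding M3_def by (auto intro: generate.incl)
  note acts = acts_as_compose[of _ True _ _ True, simplified]
  have "A \<in> generate SL2Z {mat2 1 2 0 1, mat2 1 0 2 1}"
    using assms by (simp add: Gamma2_def)
  then have "\<exists>m\<in>M3_half_pi. acts_as m False A"
  proof (induction rule: generate.induct)
    case one
    have "(\<lambda>x\<in>topspace S_half_pi. x) \<in> M3_half_pi"
      unfolding M3_def using generate.one[of "BijGroup (topspace S_half_pi)"] by (simp add: BijGroup_def)
    then show ?case
      using acts_as_id by (auto simp: SL2Z_def)
  next
    case (incl h)
    have "acts_as (compose (topspace S_half_pi) ?n1 ?n2) False (mat2 1 2 0 1)"
      "acts_as (compose (topspace S_half_pi) ?n3 ?n2) False (mat2 1 0 2 1)"
      using acts[OF modifications_act(1) modifications_act(2)] acts[OF modifications_act(3) modifications_act(2)]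
      by (simp_all add: reflection_def mat2_mult)
    then show ?case
      using incl compose_M3[OF n(1) n(2)] compose_M3[OF n(3) n(2)] by blast
  next
    case (inv h)
    \<comment> \<open>The modifications are involutions, so reversing the order inverts the products
      used for the generators. The entries \<open>- 0\<close> reproduce the shape given by
      \<open>inv_SL2Z\<close>.\<close>
    have "acts_as (compose (topspace S_half_pi) ?n2 ?n1) False (mat2 1 (- 2) (- 0) 1)"
      "acts_as (compose (topspace S_half_pi) ?n2 ?n3) False (mat2 1 (- 0) (- 2) 1)"
      using acts[OF modifications_act(2) modifications_act(1)] acts[OF modifications_act(2) modifications_act(3)]
      by (simp_all add: reflection_def mat2_mult)
    moreover have "inv\<^bsub>SL2Z\<^esub> (mat2 1 2 0 1) = mat2 1 (- 2) (- 0) 1" "inv\<^bsub>SL2Z\<^esub> (mat2 1 0 2 1) = mat2 1 (- 0) (- 2) 1"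
      by (rule inv_SL2Z; simp)+
    ultimately show ?case
      using inv compose_M3[OF n(2) n(1)] compose_M3[OF n(2) n(3)] by auto
  next
    case (eng A B)
    then obtain m m' where "m \<in> M3_half_pi" "acts_as m False A" "m' \<in> M3_half_pi" "acts_as m' False B"
      by blast
    then have "compose (topspace S_half_pi) m m' \<in> M3_half_pi"
      "acts_as (compose (topspace S_half_pi) m m') False (A ** B)"
      using compose_M3 acts_as_compose[of m False A m' False B] by auto
    then show ?case
      by (auto simp: SL2Z_def)
  qed
  then obtain m where m: "m \<in> M3_half_pi" "acts_as m False A"
    by blast
  have "fst (m x) = fst x" if "x \<in> topspace S_half_pi" for x
    using m(2) that unfolding acts_as_def topspace_S by auto
  then have "m \<in> M_half_pi"
    unfolding M_def using m(1) by blast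
  then show thesis
    using m(2) by (rule that)
qed

subsection \<open>The component of a given type\<close>

abbreviation "C_half_pi ty \<equiv> component_of_type ty (pi / 2) (pi / 2) (pi / 2) (pi / 2)"

lemma component_eq: "C_half_pi ty = Pair ty ` range standard_class"
  by (auto simp: component_of_type_def topspace_S)

lemma continuous_map_standard_class_S:
  "continuous_map euclidean (subtopology S_half_pi (C_half_pi ty)) (\<lambda>v. (ty, standard_class v))"
proof -
  have "continuous_map (hexagon_classes_top ty) S_half_pi (Pair ty)"
    unfolding S_def
    by (rule continuous_map_component_injection[of ty UNIV "\<lambda>ty. hexagon_classes_top ty"]) simp
  from continuous_map_compose[OF continuous_map_standard_class this] show ?thesis
    by (auto simp: continuous_map_in_subtopology o_def component_eq)
qed

lemma topspace_component: "topspace (subtopology S_half_pi (C_half_pi ty)) = C_half_pi ty"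
  by (auto simp: component_of_type_def)

text \<open>Each summand of the disjoint union is clopen, and it is connected as a continuous image
  of the plane.\<close>

lemma component_connected: "C_half_pi ty \<in> connected_components_of S_half_pi"
proof -
  have clopen: "openin S_half_pi (C_half_pi ty')" for ty'
  proof -
    have "{K. (i, K) \<in> Pair ty' ` range standard_class} = (if i = ty' then range standard_class else {})" for i
      by auto
    then show ?thesis
      unfolding S_def openin_sum_topology component_eq
      using openin_topspace[of "hexagon_classes_top ty'"] by (auto simp: topspace_hexagon_classes_top)
  qed
  moreover have "topspace S_half_pi - C_half_pi ty = C_half_pi (other_type ty)"
    unfolding component_of_type_def by (cases ty) (auto, (metis hex_type.exhaust)+)
  ultimately have "closedin S_half_pi (C_half_pi ty)"
    unfolding closedin_def by (auto simp: component_of_type_def)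
  have "connectedin S_half_pi ((\<lambda>v. (ty, standard_class v)) ` UNIV)"
    using continuous_map_standard_class_S[of ty] unfolding continuous_map_in_subtopology
    by (intro connectedin_continuous_map_image[of euclidean]) auto
  then have conn: "connectedin S_half_pi (C_half_pi ty)"
    by (simp add: component_eq image_image)
  have "connected_component_of_set S_half_pi (ty, standard_class 0) = C_half_pi ty"
  proof (rule connected_component_of_unique)
    show "(ty, standard_class 0) \<in> C_half_pi ty"
      by (auto simp: component_eq)
    show "D \<subseteq> C_half_pi ty" if "(ty, standard_class 0) \<in> D \<and> connectedin S_half_pi D" for D
      using connectedin_clopen_cases[of S_half_pi D "C_half_pi ty"] clopen \<open>closedin _ _\<close> that
      by (auto simp: component_eq disjnt_def)
  qed (rule conn)
  then show ?thesis
    unfolding connected_components_of_def by (auto simp: topspace_S)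
qed

definition component_to_plane :: "hex_type \<times> 'v set quad set \<Rightarrow> (real^2) set"
  where "component_to_plane x = class_to_plane (snd x)"

lemma component_to_plane_standard: "component_to_plane (ty, standard_class v) = pm_class v"
  by (simp add: component_to_plane_def class_to_plane_standard)

lemma homeomorphic_map_component_to_plane:
  "homeomorphic_map (subtopology S_half_pi (C_half_pi ty)) plane_mod_pm component_to_plane"
proof -
  have "continuous_map (subtopology S_half_pi (C_half_pi ty)) (hexagon_classes_top ty) snd"
    unfolding continuous_map_def
  proof (intro conjI allI impI)
    show "snd \<in> topspace (subtopology S_half_pi (C_half_pi ty)) \<rightarrow> topspace (hexagon_classes_top ty)"
      by (auto simp: topspace_component component_eq topspace_hexagon_classes_top)
    fix U assume U: "openin (hexagon_classes_top ty) U"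
    then have "U \<subseteq> range standard_class"
      using openin_subset topspace_hexagon_classes_top by metis
    then have "{x \<in> topspace (subtopology S_half_pi (C_half_pi ty)). snd x \<in> U} = Pair ty ` U"
      by (auto simp: topspace_component component_eq topspace_S image_iff)
    moreover have "openin S_half_pi (Pair ty ` U)"
      unfolding S_def by (rule open_map_component_injection[unfolded open_map_def, rule_format]) (use U in auto)
    ultimately show "openin (subtopology S_half_pi (C_half_pi ty))
        {x \<in> topspace (subtopology S_half_pi (C_half_pi ty)). snd x \<in> U}"
      unfolding openin_subtopology using \<open>U \<subseteq> range standard_class\<close>
      by (intro exI[of _ "Pair ty ` U"]) (auto simp: component_eq topspace_S)
  qed
  then have "continuous_map (subtopology S_half_pi (C_half_pi ty)) plane_mod_pm (class_to_plane \<circ> snd)"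
    using homeomorphic_maps_class_to_plane[of ty] unfolding homeomorphic_maps_def
    by (auto intro: continuous_map_compose)
  then have "continuous_map (subtopology S_half_pi (C_half_pi ty)) plane_mod_pm component_to_plane"
    by (simp add: o_def component_to_plane_def[abs_def])
  moreover have "continuous_map plane_mod_pm (subtopology S_half_pi (C_half_pi ty)) (\<lambda>p. (ty, plane_to_class p))"
    by (rule continuous_compose_quotient_map[OF quotient_map_pm_class])
      (simp add: o_def plane_to_class_pm_class continuous_map_standard_class_S)
  ultimately have "homeomorphic_maps (subtopology S_half_pi (C_half_pi ty)) plane_mod_pm
      component_to_plane (\<lambda>p. (ty, plane_to_class p))"
    unfolding homeomorphic_maps_def topspace_component topspace_plane_mod_pm component_eq
    by (auto simp: component_to_plane_standard plane_to_class_pm_class)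
  then show ?thesis
    using homeomorphic_map_maps by blast
qed

lemma inv_component_to_plane:
  "inv_into (C_half_pi ty) component_to_plane (pm_class v) = (ty, standard_class v)"
proof (rule inv_into_f_eq)
  show "inj_on component_to_plane (C_half_pi ty)"
    using homeomorphic_imp_injective_map[OF homeomorphic_map_component_to_plane[of ty]]
    unfolding topspace_component .
qed (simp_all add: component_eq component_to_plane_standard)

lemma transported_action:
  assumes "acts_as m False A"
  shows "(\<lambda>p\<in>topspace plane_mod_pm. component_to_plane (m (inv_into (C_half_pi ty) component_to_plane p)))
    = linear_action A"
proof
  fix p
  show "(\<lambda>p\<in>topspace plane_mod_pm. component_to_plane (m (inv_into (C_half_pi ty) component_to_plane p))) p
    = linear_action A p"
  proof (cases "p \<in> topspace plane_mod_pm")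
    case True
    then obtain v where p: "p = pm_class v"
      by (auto simp: topspace_plane_mod_pm)
    have "m (ty, standard_class v) = (ty, standard_class (int_act A v))"
      using assms by (simp add: acts_as_def)
    then have "component_to_plane (m (inv_into (C_half_pi ty) component_to_plane p)) = pm_class (int_act A v)"
      unfolding p inv_component_to_plane by (simp add: component_to_plane_standard)
    then show ?thesis
      using True by (simp add: linear_action_def) (simp add: p pm_class_def int_act_minus)
  qed (simp add: linear_action_def)
qed

lemma transported_group:
  "(\<lambda>m. \<lambda>p\<in>topspace plane_mod_pm. component_to_plane (m (inv_into (C_half_pi ty) component_to_plane p)))
    ` M_half_pi = linear_action ` Gamma2" (is "?T ` _ = _")
proof (intro equalityI subsetI)
  fix t assume "t \<in> ?T ` M_half_pi"
  then obtain m where m: "t = ?T m" "m \<in> M_half_pi"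
    by (rule imageE)
  obtain A where A: "A \<in> Gamma2" "acts_as m False A"
    using M_acts_as[OF m(2)] .
  then show "t \<in> linear_action ` Gamma2"
    unfolding m(1) transported_action[OF A(2)] by (intro imageI)
next
  fix t assume "t \<in> linear_action ` Gamma2"
  then obtain A where A: "t = linear_action A" "A \<in> Gamma2"
    by (rule imageE)
  obtain m where m: "m \<in> M_half_pi" "acts_as m False A"
    using Gamma2_acts[OF A(2)] .
  show "t \<in> ?T ` M_half_pi"
    unfolding A(1) transported_action[OF m(2), of ty, symmetric] by (rule imageI[OF m(1)])
qed

text \<open>Density is tested in the plane itself: the preimage of an open set meeting the component
  is open and nonempty, so \<open>orbit_dense\<close> applies to it.\<close>

lemma dense_orbit_component:
  assumes "irrational_slope v"
  shows "(subtopology S_half_pi (C_half_pi ty)) closure_of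
    ((\<lambda>m. m (inv_into (C_half_pi ty) component_to_plane (pm_class v))) ` M_half_pi) = C_half_pi ty"
proof (intro equalityI subsetI)
  let ?X = "subtopology S_half_pi (C_half_pi ty)"
  fix x
  show "x \<in> C_half_pi ty" if "x \<in> ?X closure_of
      ((\<lambda>m. m (inv_into (C_half_pi ty) component_to_plane (pm_class v))) ` M_half_pi)"
    using subsetD[OF closure_of_subset_topspace that] by (simp only: topspace_component)
  assume x: "x \<in> C_half_pi ty"
  show "x \<in> ?X closure_of
      ((\<lambda>m. m (inv_into (C_half_pi ty) component_to_plane (pm_class v))) ` M_half_pi)"
    unfolding in_closure_of topspace_component inv_component_to_plane
  proof (intro conjI allI impI x)
    fix U assume U: "x \<in> U \<and> openin ?X U"
    define W where "W = {w. (ty, standard_class w) \<in> U}"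
    have "open W"
      using openin_continuous_map_preimage[OF continuous_map_standard_class_S[of ty], of U] U
      by (simp add: W_def)
    moreover have "W \<noteq> {}"
      using x U by (auto simp: W_def component_eq)
    ultimately obtain A where A: "A \<in> Gamma2" "int_act A v \<in> W"
      using orbit_dense[OF assms] by blast
    obtain m where m: "m \<in> M_half_pi" "acts_as m False A"
      using Gamma2_acts[OF A(1)] .
    have "m (ty, standard_class v) \<in> U"
      using m(2) A(2) by (simp add: acts_as_def W_def)
    then show "\<exists>y. y \<in> (\<lambda>m. m (ty, standard_class v)) ` M_half_pi \<and> y \<in> U"
      using m(1) by blast
  qed
qed

end

section \<open>Existence of an orthonormal basis and conclusion\<close>

lemma (in hermitian_plane) hermitian_basis_exists:
  obtains e f where "hermitian_basis scale form e f"
proof -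
  obtain e0 f0 where ef: "form e0 f0 = 0" "Re (form e0 e0) > 0" "Re (form f0 f0) < 0"
    using signature_1_1 by blast
  have scale_right: "form x (scale a z) = cnj a * form x z" for x a z
    by (metis complex_cnj_mult form_scale form_hermitian)
  define a b where "a = Re (form e0 e0)" and "b = - Re (form f0 f0)"
  \<comment> \<open>Hermitian symmetry makes the diagonal values real, so division by the square
    roots of their moduli normalizes the vectors.\<close>
  have real: "form e0 e0 = of_real a" "form f0 f0 = of_real (- b)"
    unfolding a_def b_def minus_minus by (metis Reals_cnj_iff form_hermitian of_real_Re)+
  define e f where "e = scale (of_real (1 / sqrt a)) e0" and "f = scale (of_real (1 / sqrt b)) f0"
  have ab: "a > 0" "b > 0"
    using ef by (simp_all add: a_def b_def)
  have "form e e = of_real (1 / sqrt a * (1 / sqrt a) * a)"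
    unfolding e_def form_scale scale_right real
    by (simp only: complex_cnj_complex_of_real of_real_mult mult.assoc)
  also have "1 / sqrt a * (1 / sqrt a) * a = 1"
    using ab by simp
  finally have ee: "form e e = 1"
    by simp
  have "form f f = of_real (1 / sqrt b * (1 / sqrt b) * - b)"
    unfolding f_def form_scale scale_right real
    by (simp only: complex_cnj_complex_of_real of_real_mult mult.assoc)
  also have "1 / sqrt b * (1 / sqrt b) * - b = - 1"
    using ab by simp
  finally have ff: "form f f = - 1"
    by simp
  have "form e f = 0"
    by (simp add: e_def f_def form_scale scale_right ef(1))
  with ee ff have "hermitian_basis scale form e f"
    using hermitian_plane_axioms by (simp add: hermitian_basis_def hermitian_basis_axioms_def)
  then show thesis
    by (rule that)
qed

text \<open>Almost every point of the quotient is expressed through almost every representative in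
  the plane: a subset of the quotient is null exactly when its preimage is.\<close>

theorem mainTheorem5:
  fixes scale :: "complex \<Rightarrow> 'v::ab_group_add \<Rightarrow> 'v"
    and form :: "'v \<Rightarrow> 'v \<Rightarrow> complex"
    and ty :: hex_type
  assumes "hermitian_plane scale form"
  shows "let S = hermitian_plane.S scale form (pi/2) (pi/2) (pi/2) (pi/2);
             M = hermitian_plane.M scale form (pi/2) (pi/2) (pi/2) (pi/2);
             C = hermitian_plane.component_of_type scale form ty (pi/2) (pi/2) (pi/2) (pi/2)
         in C \<in> connected_components_of S \<and>
            (\<exists>f. homeomorphic_map (subtopology S C) plane_mod_pm f \<and>
                 (\<lambda>m. \<lambda>p\<in>topspace plane_mod_pm. f (m (inv_into C f p))) ` M
                   = linear_action ` Gamma2 \<and>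
                 (AE v in lebesgue.
                    (subtopology S C) closure_of ((\<lambda>m. m (inv_into C f (pm_class v))) ` M) = C))"
proof -
  obtain e f where "hermitian_basis scale form e f"
    by (rule hermitian_plane.hermitian_basis_exists[OF assms])
  then interpret hermitian_basis scale form e f .
  have "AE v in lebesgue. (subtopology S_half_pi (C_half_pi ty)) closure_of
    ((\<lambda>m. m (inv_into (C_half_pi ty) component_to_plane (pm_class v))) ` M_half_pi) = C_half_pi ty"
    using AE_irrational_slope by (rule AE_mp) (auto intro!: AE_I2 dest: dense_orbit_component)
  then show ?thesis
    unfolding Let_def
    using component_connected homeomorphic_map_component_to_plane transported_group by blast
qed

end
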